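(* Let $\nu,d\in\mathbb{N}$, let $\Psi$ be a real symmetric positive definite $\nu\times\nu$ matrix and $\Sigma$ a real symmetric positive definite $d\times d$ matrix. For an $\mathbb{R}^{\nu\times d}$-valued random matrix $\mathfrak{X}$, one has $$\mathfrak{X}\sim\mathcal{N}_{\nu\times d}(0_{\nu\times d},\Psi\otimes\Sigma)\quad\Longleftrightarrow\quad \mathsf{E}\big[\mathcal{A}^{\mathrm{OU}}f(\mathfrak{X})\big]=0\ \text{ for all } f\in C^2_{\mathcal{A}^{\mathrm{OU}}}(\mathbb{R}^{\nu\times d}),$$ where $$\mathcal{A}^{\mathrm{OU}}f(X)=-\mathrm{tr}\{X^{\top}\nabla f(X)\}+\mathrm{tr}\{\Sigma\nabla^{\top}\Psi\nabla f(X)\}$$ and $$C^2_{\mathcal{A}^{\mathrm{OU}}}(\mathbb{R}^{\nu\times d})=\Big\{f\in C^2(\mathbb{R}^{\nu\times d}):\ \mathsf{E}\big[|\mathrm{tr}\{\mathfrak{X}^\top\nabla f(\mathfrak{X})\}|\big]<\infty,\ \mathsf{E}\big[|\mathrm{tr}\{\Sigma\nabla^\top\Psi\nabla f(\mathfrak{X})\}|\big]<\infty\Big\}.$$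
   Context: $\nabla=(\partial/\partial X_{ij})_{1\le i\le\nu,1\le j\le d}$ is the $\nu\times d$ matrix of first-order partial derivatives, so $\mathrm{tr}\{X^\top\nabla f(X)\}=\sum_{i,j}X_{ij}\,\partial f(X)/\partial X_{ij}$ and $\mathrm{tr}\{\Sigma\nabla^{\top}\Psi\nabla f(X)\}=\sum_{i,k=1}^{\nu}\sum_{j,\ell=1}^{d}\Psi_{ik}\Sigma_{j\ell}\,\partial^2 f(X)/(\partial X_{ij}\partial X_{k\ell})$. $\mathfrak{N}\sim\mathcal{N}_{\nu\times d}(M,\Psi\otimes\Sigma)$ means $\mathrm{vec}(\mathfrak{N}^\top)\sim\mathcal{N}_{\nu d}(\mathrm{vec}(M^\top),\Psi\otimes\Sigma)$, where $\mathrm{vec}$ stacks columns and $\otimes$ is the Kronecker product. *)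

theory Defs
  imports "HOL-Probability.Probability"
begin

definition sym_pos_def :: "real^'n^'n \<Rightarrow> bool" where
  "sym_pos_def A \<longleftrightarrow> transpose A = A \<and> (\<forall>x. x \<noteq> 0 \<longrightarrow> 0 < x \<bullet> (A *v x))"


text \<open>
  A \<open>\<nu> \<times> d\<close> matrix has type \<open>real^'d^'n\<close>, with \<open>X $ i $ j\<close> the entry in row \<open>i\<close> and column \<open>j\<close>.
  Vectors of length \<open>\<nu> d\<close> are indexed by pairs, thought of as ordered lexicographically (first
  component slowest). Thus column stacking uses the column index as the first component, and
  \<open>kronecker A B\<close> is the block matrix with blocks \<open>A $ i $ k *\<^sub>R B\<close>.
\<close>

definition vec_cols :: "'a^'n^'m \<Rightarrow> 'a^('n \<times> 'm)" where
  "vec_cols A = (\<chi> p. A $ snd p $ fst p)"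

definition kronecker :: "real^'n^'m \<Rightarrow> real^'q^'p \<Rightarrow> real^('n \<times> 'q)^('m \<times> 'p)" where
  "kronecker A B = (\<chi> r c. A $ fst r $ fst c * B $ snd r $ snd c)"


text \<open>The normal distribution, given by its density; it is meant for positive definite \<open>S\<close> only.\<close>

definition mvn_density :: "real^'n \<Rightarrow> real^'n^'n \<Rightarrow> real^'n \<Rightarrow> real" where
  "mvn_density m S x =
     exp (- ((x - m) \<bullet> (matrix_inv S *v (x - m))) / 2) / sqrt ((2 * pi) ^ CARD('n) * det S)"

definition multivariate_normal ::
    "'a measure \<Rightarrow> ('a \<Rightarrow> real^'n) \<Rightarrow> real^'n \<Rightarrow> real^'n^'n \<Rightarrow> bool" where
  "multivariate_normal M X m S \<longleftrightarrow> distributed M lborel X (mvn_density m S)"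

definition matrix_normal ::
    "'a measure \<Rightarrow> ('a \<Rightarrow> real^'d^'n) \<Rightarrow> real^'d^'n \<Rightarrow> real^'n^'n \<Rightarrow> real^'d^'d \<Rightarrow> bool" where
  "matrix_normal M X \<mu> \<Psi> \<Sigma> \<longleftrightarrow>
     multivariate_normal M (\<lambda>\<omega>. vec_cols (transpose (X \<omega>))) (vec_cols (transpose \<mu>)) (kronecker \<Psi> \<Sigma>)"


definition partial :: "'n \<Rightarrow> 'd \<Rightarrow> (real^'d^'n \<Rightarrow> real) \<Rightarrow> real^'d^'n \<Rightarrow> real" where
  "partial i j f X = deriv (\<lambda>t. f (X + t *\<^sub>R axis i (axis j 1))) 0"

definition nabla :: "(real^'d^'n \<Rightarrow> real) \<Rightarrow> real^'d^'n \<Rightarrow> real^'d^'n" where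
  "nabla f X = (\<chi> i j. partial i j f X)"

definition C1 :: "(real^'d^'n \<Rightarrow> real) \<Rightarrow> bool" where
  "C1 f \<longleftrightarrow> (\<forall>X. f differentiable (at X)) \<and> (\<forall>i j. continuous_on UNIV (partial i j f))"

definition C2 :: "(real^'d^'n \<Rightarrow> real) \<Rightarrow> bool" where
  "C2 f \<longleftrightarrow> C1 f \<and> (\<forall>i j. C1 (partial i j f))"

definition drift_term :: "(real^'d^'n \<Rightarrow> real) \<Rightarrow> real^'d^'n \<Rightarrow> real" where
  "drift_term f X = trace (transpose X ** nabla f X)"

text \<open>\<open>tr {\<Sigma> \<nabla>\<^sup>T \<Psi> \<nabla> f(X)}\<close>, where \<open>\<nabla>\<close> is the matrix of the operators \<^const>\<open>partial\<close>:\<close>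

definition diffusion_term ::
    "real^'n^'n \<Rightarrow> real^'d^'d \<Rightarrow> (real^'d^'n \<Rightarrow> real) \<Rightarrow> real^'d^'n \<Rightarrow> real" where
  "diffusion_term \<Psi> \<Sigma> f X =
     (\<Sum>i\<in>UNIV. \<Sum>k\<in>UNIV. \<Sum>j\<in>UNIV. \<Sum>l\<in>UNIV.
        \<Psi> $ i $ k * \<Sigma> $ j $ l * partial i j (partial k l f) X)"

definition OU_generator ::
    "real^'n^'n \<Rightarrow> real^'d^'d \<Rightarrow> (real^'d^'n \<Rightarrow> real) \<Rightarrow> real^'d^'n \<Rightarrow> real" where
  "OU_generator \<Psi> \<Sigma> f X = - drift_term f X + diffusion_term \<Psi> \<Sigma> f X"

definition OU_class ::
    "'a measure \<Rightarrow> ('a \<Rightarrow> real^'d^'n) \<Rightarrow> real^'n^'n \<Rightarrow> real^'d^'d \<Rightarrow> (real^'d^'n \<Rightarrow> real) set" where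
  "OU_class M X \<Psi> \<Sigma> =
     {f. C2 f \<and> integrable M (\<lambda>\<omega>. drift_term f (X \<omega>))
              \<and> integrable M (\<lambda>\<omega>. diffusion_term \<Psi> \<Sigma> f (X \<omega>))}"

end

theory Submission
  imports Defs
begin

text \<open>
  After vectorization, let \<open>S = C C\<^sup>T\<close> be the covariance matrix and \<open>q x = x \<bullet> S\<^sup>-\<^sup>1 x\<close>. If \<open>X\<close> is normal with
  density \<open>\<phi>\<close>, the generator is \<open>A f = \<phi>\<^sup>-\<^sup>1 div (\<phi> S \<nabla>f)\<close>; integrating against \<open>\<phi> \<eta>(q / R)\<close> with a cutoff
  \<open>\<eta>\<close> and letting \<open>R \<rightarrow> \<infinity>\<close> gives \<open>E (A f) = 0\<close>. The cutoff is a function of \<open>q\<close>, so only the radial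
  derivative \<open>x \<bullet> \<nabla>f\<close> enters the error term, and integrability of the two terms of \<open>A f\<close> suffices.

  Conversely, apply the hypothesis to the image of a Gaussian bump under the Ornstein-Uhlenbeck semigroup.
  These images are again Gaussian bumps, explicitly known, and \<open>E (A f) = 0\<close> says that their
  expectation is constant along the flow; letting time tend to infinity determines the expectation of
  every Gaussian bump. Hence \<open>X\<close> and the normal law give the same expectation to all Gaussian bumps,
  and since the latter form approximate identities the laws coincide.
\<close>

subsection \<open>Linear change of variables\<close>

text \<open>With the coordinate along \<open>i\<close> split off and the others fixed, the shear is
  a translation by the constant \<open>x \<bullet> j\<close>, which leaves one-dimensional Lebesgue
  measure unchanged. This is the last elementary case of the linear change of variables.\<close>

lemma nn_integral_lborel_shear:
  fixes g :: "'v::euclidean_space \<Rightarrow> ennreal"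
  assumes g [measurable]: "g \<in> borel_measurable borel"
    and ij: "i \<in> Basis" "j \<in> Basis" "i \<noteq> j"
  shows "(\<integral>\<^sup>+x. g (x + (x \<bullet> j) *\<^sub>R i) \<partial>lborel) = (\<integral>\<^sup>+x. g x \<partial>lborel)"
proof -
  interpret product_sigma_finite "\<lambda>b::'v. lborel :: real measure"
    by standard
  define B where "B = Basis - {i}"
  have B: "finite B" "i \<notin> B" "Basis = insert i B" "j \<in> B"
    using ij by (auto simp: B_def)
  have split: "(\<integral>\<^sup>+x. h x \<partial>lborel) =
      (\<integral>\<^sup>+f. (\<integral>\<^sup>+t. h (t *\<^sub>R i + (\<Sum>b\<in>B. f b *\<^sub>R b)) \<partial>lborel) \<partial>(\<Pi>\<^sub>M b\<in>B. lborel))"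
    if [measurable]: "h \<in> borel_measurable borel" for h :: "'v \<Rightarrow> ennreal"
  proof -
    have "(\<integral>\<^sup>+x. h x \<partial>lborel) = (\<integral>\<^sup>+f. h (\<Sum>b\<in>Basis. f b *\<^sub>R b) \<partial>(\<Pi>\<^sub>M b\<in>Basis. lborel))"
      unfolding lborel_def[where 'a='v] lborel_eq_real[symmetric] by (subst nn_integral_distr) auto
    also have "\<dots> = (\<integral>\<^sup>+f. (\<integral>\<^sup>+t. h (\<Sum>b\<in>insert i B. (f(i := t)) b *\<^sub>R b) \<partial>lborel) \<partial>(\<Pi>\<^sub>M b\<in>B. lborel))"
      unfolding B(3) by (rule product_nn_integral_insert) (use B in \<open>auto simp flip: B(3)\<close>)
    also have "\<dots> = (\<integral>\<^sup>+f. (\<integral>\<^sup>+t. h (t *\<^sub>R i + (\<Sum>b\<in>B. f b *\<^sub>R b)) \<partial>lborel) \<partial>(\<Pi>\<^sub>M b\<in>B. lborel))"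
    proof (intro nn_integral_cong)
      fix f :: "'v \<Rightarrow> real" and t
      have "(\<Sum>b\<in>insert i B. (f(i := t)) b *\<^sub>R b) = t *\<^sub>R i + (\<Sum>b\<in>B. f b *\<^sub>R b)"
        by (subst sum.insert[OF B(1,2)]) (use B(2) in \<open>auto intro!: sum.cong\<close>)
      then show "h (\<Sum>b\<in>insert i B. (f(i := t)) b *\<^sub>R b) = h (t *\<^sub>R i + (\<Sum>b\<in>B. f b *\<^sub>R b))"
        by simp
    qed
    finally show ?thesis .
  qed
  have proj: "(t *\<^sub>R i + (\<Sum>b\<in>B. f b *\<^sub>R b)) \<bullet> j = f j" for t and f :: "'v \<Rightarrow> real"
  proof -
    have "(\<Sum>b\<in>B. f b *\<^sub>R b) \<bullet> j = (\<Sum>b\<in>B. if b = j then f b else 0)"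
      unfolding inner_sum_left using B ij by (intro sum.cong) (auto simp: inner_Basis)
    also have "\<dots> = f j" using B by simp
    finally show ?thesis
      using ij by (simp add: inner_add_left inner_Basis)
  qed
  have shift: "(\<integral>\<^sup>+t. h (s + t) \<partial>lborel) = (\<integral>\<^sup>+t. h t \<partial>lborel)"
    if "h \<in> borel_measurable borel" for h :: "real \<Rightarrow> ennreal" and s
    using nn_integral_real_affine[OF that, of 1 s] by simp
  have m [measurable]: "(\<lambda>x. g (x + (x \<bullet> j) *\<^sub>R i)) \<in> borel_measurable borel"
    by measurable
  have "(\<integral>\<^sup>+t. g (t *\<^sub>R i + (\<Sum>b\<in>B. f b *\<^sub>R b) + f j *\<^sub>R i) \<partial>lborel) =
        (\<integral>\<^sup>+t. g (t *\<^sub>R i + (\<Sum>b\<in>B. f b *\<^sub>R b)) \<partial>lborel)" for f :: "'v \<Rightarrow> real"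
    using shift[of "\<lambda>t. g (t *\<^sub>R i + (\<Sum>b\<in>B. f b *\<^sub>R b))" "f j"]
    by (simp add: algebra_simps)
  then show ?thesis
    unfolding split[OF g] split[OF m] proj by simp
qed

text \<open>
  Unlike \<open>measure_linear_image\<close>, the following does not need a well-ordered index type; the index type
  needed below is a product, which is not an instance of \<open>wellorder\<close>.
\<close>

lemma nn_integral_lborel_linear:
  fixes f :: "real^'m \<Rightarrow> real^'m" and g :: "real^'m \<Rightarrow> ennreal"
  assumes f: "linear f" and "det (matrix f) \<noteq> 0" and g: "g \<in> borel_measurable borel"
  shows "(\<integral>\<^sup>+x. g x \<partial>lborel) = ennreal \<bar>det (matrix f)\<bar> * (\<integral>\<^sup>+x. g (f x) \<partial>lborel)"
proof -
  \<comment> \<open>The nonzero determinant is a premise inside \<open>P\<close>, so singular maps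
    satisfy it vacuously in the induction over elementary maps. The integrand is quantified inside
    \<open>P\<close> because the composition case applies it to the composite of \<open>h\<close>
    with a linear map.\<close>
  define P where "P f \<longleftrightarrow> det (matrix f) \<noteq> 0 \<longrightarrow> (\<forall>g\<in>borel_measurable borel.
    (\<integral>\<^sup>+x. g x \<partial>lborel) = ennreal \<bar>det (matrix f)\<bar> * (\<integral>\<^sup>+x. g (f x) \<partial>lborel))"
    for f :: "real^'m \<Rightarrow> real^'m"
  have meas [measurable]: "f \<in> borel_measurable borel" if "linear f" for f :: "real^'m \<Rightarrow> real^'m"
    using that by (intro borel_measurable_continuous_onI linear_continuous_on) (simp add: linear_conv_bounded_linear)
  from f have "P f"
  proof (rule induct_linear_elementary[where P = P])
    fix f g :: "real^'m \<Rightarrow> real^'m"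
    assume fg: "linear f" "linear g" and P: "P f" "P g"
    have d: "det (matrix (f \<circ> g)) = det (matrix f) * det (matrix g)"
      by (simp only: matrix_compose[OF fg(2,1)] det_mul)
    show "P (f \<circ> g)"
      unfolding P_def
    proof (intro impI ballI)
      assume nz: "det (matrix (f \<circ> g)) \<noteq> 0"
      fix h :: "real^'m \<Rightarrow> ennreal" assume h [measurable]: "h \<in> borel_measurable borel"
      note [measurable] = meas[OF fg(1)] meas[OF fg(2)]
      have "(\<integral>\<^sup>+x. h x \<partial>lborel) = ennreal \<bar>det (matrix f)\<bar> * (\<integral>\<^sup>+x. h (f x) \<partial>lborel)"
        using P(1)[unfolded P_def, rule_format, of h] nz h unfolding d by (metis mult_eq_0_iff)
      also have "(\<integral>\<^sup>+x. h (f x) \<partial>lborel) = ennreal \<bar>det (matrix g)\<bar> * (\<integral>\<^sup>+x. h (f (g x)) \<partial>lborel)"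
        using P(2)[unfolded P_def, rule_format, of "\<lambda>x. h (f x)"] nz unfolding d
        by (metis (no_types, lifting) mult_eq_0_iff measurable_compose[OF meas[OF fg(1)] h])
      finally show "(\<integral>\<^sup>+x. h x \<partial>lborel) =
          ennreal \<bar>det (matrix (f \<circ> g))\<bar> * (\<integral>\<^sup>+x. h ((f \<circ> g) x) \<partial>lborel)"
        by (simp add: d abs_mult ennreal_mult mult.assoc)
    qed
  next
    fix f :: "real^'m \<Rightarrow> real^'m" and i
    assume "linear f" and 0: "\<And>x. f x $ i = 0"
    then have "\<not> inj f"
      by (metis linear_injective_imp_surjective one_neq_zero surjE vec_component)
    then show "P f"
      using det_nz_iff_inj[OF \<open>linear f\<close>] by (simp add: P_def)
  next
    fix c :: "'m \<Rightarrow> real"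
    let ?f = "\<lambda>x::real^'m. \<chi> i. c i * x $ i"
    have d: "det (matrix ?f) = (\<Prod>i\<in>UNIV. c i)"
      by (simp add: axis_def matrix_def det_diagonal)
    show "P ?f"
      unfolding P_def d
    proof (intro impI ballI)
      assume nz: "(\<Prod>i\<in>UNIV. c i) \<noteq> 0"
      fix h :: "real^'m \<Rightarrow> ennreal" assume [measurable]: "h \<in> borel_measurable borel"
      \<comment> \<open>The diagonal map, written as a sum over \<open>Basis\<close> with offset 0
        to match the form of \<open>lborel_affine_euclidean\<close>.\<close>
      define T where "T x = 0 + (\<Sum>j\<in>Basis. (c (axis_index j) * (x \<bullet> j)) *\<^sub>R j)" for x :: "real^'m"
      have inj: "inj (\<lambda>i::'m. axis i (1::real))"
        by (simp add: inj_on_def axis_eq_axis)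
      have Basis_eq: "(Basis :: (real^'m) set) = range (\<lambda>i. axis i 1)"
        by (auto simp: Basis_vec_def)
      have T: "T = ?f"
        unfolding T_def Basis_eq
        by (subst sum.reindex[OF inj], simp only: o_def axis_index_axis inner_axis)
          (auto simp: fun_eq_iff vec_eq_iff axis_def if_distrib[of "(*) _"] cong: if_cong)
      have "linear T" unfolding T
        by (rule linearI) (auto simp: vec_eq_iff algebra_simps)
      note [measurable] = meas[OF this]
      have p: "(\<Prod>j\<in>(Basis :: (real^'m) set). \<bar>c (axis_index j)\<bar>) = \<bar>\<Prod>i\<in>UNIV. c i\<bar>"
        unfolding Basis_eq by (subst prod.reindex[OF inj]) (simp add: axis_index_axis abs_prod)
      have "lborel = density (distr lborel borel T) (\<lambda>_. (\<Prod>j\<in>(Basis :: (real^'m) set). \<bar>c (axis_index j)\<bar>))"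
        unfolding T_def using nz by (intro lborel_affine_euclidean) auto
      then have "(\<integral>\<^sup>+x. h x \<partial>lborel) = (\<integral>\<^sup>+x. h x \<partial>density (distr lborel borel T) (\<lambda>_. ennreal \<bar>\<Prod>i\<in>UNIV. c i\<bar>))"
        unfolding p by simp
      also have "\<dots> = ennreal \<bar>\<Prod>i\<in>UNIV. c i\<bar> * (\<integral>\<^sup>+x. h (T x) \<partial>lborel)"
        by (simp add: nn_integral_density nn_integral_distr nn_integral_cmult)
      finally show "(\<integral>\<^sup>+x. h x \<partial>lborel) = ennreal \<bar>\<Prod>i\<in>UNIV. c i\<bar> * (\<integral>\<^sup>+x. h (?f x) \<partial>lborel)"
        unfolding T .
    qed
  next
    fix m n :: 'm assume "m \<noteq> n"
    let ?p = "Transposition.transpose m n"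
    let ?f = "\<lambda>x::real^'m. \<chi> i. x $ ?p i"
    have lin: "linear ?f"
      by (rule linearI) (simp_all add: vec_eq_iff)
    note [measurable] = meas[OF lin]
    have "(\<chi> i j. if ?p i = j then 1 else 0) = (\<chi> i j. if j = ?p i then 1 else (0::real))"
      by (auto intro!: Cart_lambda_cong)
    then have "matrix ?f = transpose (\<chi> i j. mat 1 $ i $ ?p j)"
      by (auto simp: transpose_def axis_def mat_def matrix_def)
    then have d: "\<bar>det (matrix ?f)\<bar> = 1"
      by (simp add: det_permute_columns permutes_swap_id sign_swap_id abs_mult)
    have inj: "inj (\<lambda>i::'m. axis i (1::real))"
      by (simp add: inj_on_def axis_eq_axis)
    have Basis_eq: "(Basis :: (real^'m) set) = range (\<lambda>i. axis i 1)"
      by (auto simp: Basis_vec_def)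
    \<comment> \<open>A permutation of coordinates maps boxes to boxes with permuted side lengths,
      hence equal volume, and the volumes of boxes determine Lebesgue measure.\<close>
    have eq: "lborel = distr lborel borel ?f"
    proof (rule lborel_eqI)
      fix l u :: "real^'m"
      assume le: "\<And>b. b \<in> Basis \<Longrightarrow> l \<bullet> b \<le> u \<bullet> b"
      have vim: "?f -` box l u = box (?f l) (?f u)"
        by (auto simp: mem_box_cart) (metis transpose_involutory)+
      have le': "l $ i \<le> u $ i" for i
        using le[of "axis i 1"] by (simp add: Basis_eq inner_axis)
      have "emeasure (distr lborel borel ?f) (box l u) = emeasure lborel (box (?f l) (?f u))"
        by (subst emeasure_distr) (auto simp: vim)
      also have "\<dots> = (\<Prod>b\<in>Basis. (?f u - ?f l) \<bullet> b)"
        using le' by (intro emeasure_lborel_box) (auto simp: Basis_eq inner_axis)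
      also have "(\<Prod>b\<in>Basis. (?f u - ?f l) \<bullet> b) = (\<Prod>i\<in>UNIV. (u - l) $ ?p i)"
        unfolding Basis_eq by (subst prod.reindex[OF inj]) (simp add: inner_axis)
      also have "\<dots> = (\<Prod>i\<in>UNIV. (u - l) $ i)"
        using prod.permute[OF permutes_swap_id, where S=UNIV and g="\<lambda>i. (u - l) $ i"]
        by (simp add: o_def)
      also have "\<dots> = (\<Prod>b\<in>Basis. (u - l) \<bullet> b)"
        unfolding Basis_eq by (subst prod.reindex[OF inj]) (simp add: inner_axis)
      finally show "emeasure (distr lborel borel ?f) (box l u) = ennreal (\<Prod>b\<in>Basis. (u - l) \<bullet> b)" .
    qed simp
    have inv: "(\<integral>\<^sup>+x. h x \<partial>lborel) = (\<integral>\<^sup>+x. h (?f x) \<partial>lborel)"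
      if "h \<in> borel_measurable borel" for h :: "real^'m \<Rightarrow> ennreal"
      using nn_integral_distr[of ?f lborel borel h] that unfolding eq[symmetric] by simp
    show "P ?f"
      unfolding P_def d ennreal_1 mult_1_left by (intro impI ballI) (rule inv)
  next
    fix m n :: 'm assume mn: "m \<noteq> n"
    let ?f = "\<lambda>x::real^'m. \<chi> i. if i = m then x $ m + x $ n else x $ i"
    have "matrix ?f = (\<chi> k. if k = m then row m (mat 1) + 1 *s row n (mat 1) else row k (mat 1))"
      by (auto simp: matrix_def vec_eq_iff row_def axis_def mat_def)
    then have d: "det (matrix ?f) = 1"
      using det_row_operation[OF mn, of "mat 1 :: real^'m^'m" 1] by simp
    have f: "?f x = x + (x \<bullet> axis n 1) *\<^sub>R axis m 1" for x
      using mn by (simp only: vec_eq_iff inner_axis) (auto simp: axis_def)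
    have axes: "axis m (1::real) \<in> Basis" "axis n (1::real) \<in> Basis" "axis m (1::real) \<noteq> axis n 1"
      using mn by (auto simp: axis_eq_axis Basis_vec_def)
    have inv: "(\<integral>\<^sup>+x. h x \<partial>lborel) = (\<integral>\<^sup>+x. h (?f x) \<partial>lborel)"
      if "h \<in> borel_measurable borel" for h :: "real^'m \<Rightarrow> ennreal"
      unfolding f by (rule nn_integral_lborel_shear[OF that, symmetric]) (fact axes)+
    show "P ?f"
      unfolding P_def d abs_one ennreal_1 mult_1_left by (intro impI ballI) (rule inv)
  qed
  then show ?thesis
    unfolding P_def by (elim impE) (rule assms(2), erule bspec, rule g)
qed

subsection \<open>Gaussian integrals and square roots of covariance matrices\<close>

text \<open>The value is read off from the normalization of
  \<open>std_normal_density\<close>.\<close>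

lemma nn_integral_exp_half_square:
  "(\<integral>\<^sup>+x. ennreal (exp (- (x :: real)\<^sup>2 / 2)) \<partial>lborel) = ennreal (sqrt (2 * pi))"
proof -
  interpret prob_space "density lborel (\<lambda>x. ennreal (std_normal_density x))"
    by (rule prob_space_normal_density) simp
  have "1 = (\<integral>\<^sup>+x. ennreal (std_normal_density x) \<partial>lborel)"
    using emeasure_space_1 by (simp add: emeasure_density)
  then have "ennreal (sqrt (2 * pi)) = ennreal (sqrt (2 * pi)) * (\<integral>\<^sup>+x. ennreal (std_normal_density x) \<partial>lborel)"
    by simp
  also have "\<dots> = (\<integral>\<^sup>+x. ennreal (sqrt (2 * pi)) * ennreal (std_normal_density x) \<partial>lborel)"
    by (rule nn_integral_cmult[symmetric]) simp
  also have "\<dots> = (\<integral>\<^sup>+x. ennreal (exp (- x\<^sup>2 / 2)) \<partial>lborel)"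
    by (intro nn_integral_cong) (simp add: ennreal_mult[symmetric] std_normal_density_def)
  finally show ?thesis ..
qed

text \<open>The integrand factors over an orthonormal basis, so the integral is a power of the
  one-dimensional one.\<close>

lemma nn_integral_exp_half_norm_square:
  "(\<integral>\<^sup>+x. ennreal (exp (- (norm (x :: 'v::euclidean_space))\<^sup>2 / 2)) \<partial>lborel) =
    ennreal (sqrt ((2 * pi) ^ DIM('v)))"
proof -
  have "exp (- (norm x)\<^sup>2 / 2) = (\<Prod>b\<in>Basis. exp (- (x \<bullet> b)\<^sup>2 / 2))" for x :: 'v
    unfolding power2_norm_eq_inner euclidean_inner[of x x]
    by (simp add: exp_sum[symmetric] power2_eq_square sum_divide_distrib sum_negf)
  then have "(\<integral>\<^sup>+x. ennreal (exp (- (norm (x :: 'v))\<^sup>2 / 2)) \<partial>lborel) =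
      (\<integral>\<^sup>+x. (\<Prod>b\<in>Basis. ennreal (exp (- ((x :: 'v) \<bullet> b)\<^sup>2 / 2))) \<partial>lborel)"
    by (simp add: prod_ennreal)
  also have "\<dots> = ennreal (sqrt (2 * pi)) ^ DIM('v)"
    by (subst nn_integral_lborel_prod) (simp_all only: nn_integral_exp_half_square prod_constant, simp_all)
  finally show ?thesis
    by (subst real_sqrt_power, subst ennreal_power[symmetric]) (simp_all add: less_imp_le)
qed

section \<open>Square roots of positive definite matrices\<close>

lemma matrix_inv:
  assumes "invertible A"
  shows "A ** matrix_inv A = mat 1" "matrix_inv A ** A = mat 1"
  using someI_ex[OF assms[unfolded invertible_def]] unfolding matrix_inv_def by auto

text \<open>A Gram-Schmidt basis for the inner product of \<open>A\<close> provides the square root.\<close>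

lemma sym_pos_def_factorization:
  fixes A :: "real^'n^'n"
  assumes "sym_pos_def A"
  obtains C :: "real^'n^'n" where "invertible C" "A = C ** transpose C"
proof -
  have sym: "transpose A = A" and pos: "\<And>x. x \<noteq> 0 \<Longrightarrow> 0 < x \<bullet> (A *v x)"
    using assms by (auto simp: sym_pos_def_def)
  have comm: "x \<bullet> (A *v y) = y \<bullet> (A *v x)" for x y
    by (metis sym dot_lmul_matrix inner_commute transpose_matrix_vector)
  have ex: "\<exists>b. \<forall>i\<in>I. \<forall>j\<in>I. b i \<bullet> (A *v b j) = (if i = j then 1 else 0)" for I :: "'n set"
  proof (induction I rule: finite_induct[OF finite])
    case (2 i I)
    then obtain b where b: "\<And>i j. i \<in> I \<Longrightarrow> j \<in> I \<Longrightarrow> b i \<bullet> (A *v b j) = (if i = j then 1 else 0)"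
      by blast
    \<comment> \<open>Fewer vectors than the dimension span a proper subspace, so some nonzero
      \<open>x\<close> is orthogonal to all \<open>A *v b j\<close>, that is, orthogonal to the
      chosen \<open>b j\<close> in the inner product of \<open>A\<close>. Scaling \<open>x\<close>
      gives the next basis vector.\<close>
    have "dim ((\<lambda>j. A *v b j) ` I) \<le> card I"
      by (meson \<open>finite I\<close> card_image_le dim_le_card' finite_imageI order_trans)
    also have "card I < CARD('n)"
      using 2 by (metis UNIV_I finite psubset_card_mono subset_UNIV psubsetI)
    finally have "dim ((\<lambda>j. A *v b j) ` I) < DIM(real^'n)" by simp
    from orthogonal_to_subspace_exists[OF this] obtain x where
      x: "x \<noteq> 0" "\<And>y. y \<in> span ((\<lambda>j. A *v b j) ` I) \<Longrightarrow> orthogonal x y"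
      by blast
    have x0: "x \<bullet> (A *v b j) = 0" if "j \<in> I" for j
      using x(2)[OF span_base[of "A *v b j"]] that by (auto simp: orthogonal_def)
    define y where "y = (1 / sqrt (x \<bullet> (A *v x))) *\<^sub>R x"
    have y: "y \<bullet> (A *v y) = 1"
      using pos[OF x(1)] by (simp add: y_def matrix_vector_mult_scaleR)
    have y0: "y \<bullet> (A *v b j) = 0" "b j \<bullet> (A *v y) = 0" if "j \<in> I" for j
      using x0[OF that] by (auto simp: y_def comm[of "b j"])
    show ?case
      by (rule exI[of _ "b(i := y)"]) (use 2 y y0 b in auto)
  qed simp
  obtain b :: "'n \<Rightarrow> real^'n" where b: "\<And>i j. b i \<bullet> (A *v b j) = (if i = j then 1 else 0)"
    using ex[of UNIV] by blast
  \<comment> \<open>The columns of \<open>B\<close> are orthonormal for \<open>A\<close>, so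
    \<open>B\<^sup>T A B = 1\<close>. With \<open>C\<close> the inverse of \<open>B\<^sup>T\<close>
    this says \<open>A B = C\<close>, and \<open>B C\<^sup>T = 1\<close> then gives
    \<open>A = C C\<^sup>T\<close>.\<close>
  define B where "B = (\<chi> i j. b j $ i)"
  have "(transpose B ** (A ** B)) $ i $ j = b i \<bullet> (A *v b j)" for i j
    by (simp add: B_def transpose_def matrix_matrix_mult_def matrix_vector_mult_def inner_vec_def)
  then have BAB: "transpose B ** (A ** B) = mat 1"
    by (simp add: b vec_eq_iff mat_def)
  then have "invertible (transpose B)"
    using invertible_right_inverse by blast
  define C where "C = matrix_inv (transpose B)"
  have 1: "A ** B = C"
    by (metis BAB C_def \<open>invertible (transpose B)\<close> matrix_inv(2) matrix_mul_assoc matrix_mul_lid matrix_mul_rid)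
  have "transpose (transpose B ** C) = mat 1" "transpose (C ** transpose B) = mat 1"
    unfolding C_def using \<open>invertible (transpose B)\<close> by (simp_all add: matrix_inv transpose_mat)
  then have "B ** transpose C = mat 1"
    by (simp add: matrix_transpose_mul)
  then have "A = C ** transpose C"
    by (metis 1 matrix_mul_assoc matrix_mul_rid)
  moreover have "invertible C"
    by (metis C_def \<open>invertible (transpose B)\<close> invertible_def matrix_inv)
  ultimately show thesis using that by blast
qed

section \<open>Kronecker products\<close>

lemma kronecker_mult:
  "kronecker (A :: real^'n^'m) (B :: real^'q^'p) ** kronecker (A' :: real^'k^'n) (B' :: real^'l^'q) =
    kronecker (A ** A') (B ** B')"
  by (simp add: vec_eq_iff kronecker_def matrix_matrix_mult_def sum_product UNIV_Times_UNIV[symmetric]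
      sum.cartesian_product case_prod_unfold mult_ac del: UNIV_Times_UNIV)

lemma transpose_kronecker: "transpose (kronecker A B) = kronecker (transpose A) (transpose B)"
  by (simp add: vec_eq_iff kronecker_def transpose_def)

lemma kronecker_mat: "kronecker (mat 1) (mat 1) = mat 1"
  by (auto simp: vec_eq_iff kronecker_def mat_def prod_eq_iff)

text \<open>By the mixed-product rule \<open>kronecker_mult\<close>, the Kronecker product of
  inverses is an inverse.\<close>

lemma invertible_kronecker:
  "invertible A \<Longrightarrow> invertible B \<Longrightarrow> invertible (kronecker A B)"
  unfolding invertible_def by (metis kronecker_mult kronecker_mat)

text \<open>The square root \<open>C\<close> is carried along with the covariance \<open>S\<close>:
  substituting \<open>C\<close> reduces Gaussian integrals to the standard one, and the inverse of
  \<open>C\<close> turns the quadratic form of \<open>Q\<close> into a squared Euclidean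
  norm.\<close>

locale gaussian_factor =
  fixes C S Q :: "real^'m^'m"
  assumes invertible_C: "invertible C"
    and S_eq: "S = C ** transpose C"
    and Q_eq: "Q = matrix_inv S"
begin

definition q :: "real^'m \<Rightarrow> real" where
  "q x = x \<bullet> (Q *v x)"

definition D :: "real^'m^'m" where
  "D = matrix_inv C"

lemma CD: "C ** D = mat 1" "D ** C = mat 1"
  unfolding D_def using invertible_C by (simp_all add: matrix_inv)

lemma Q_D: "Q = transpose D ** D"
proof -
  have "transpose C ** transpose D = mat 1" "transpose D ** transpose C = mat 1"
    using CD by (metis matrix_transpose_mul transpose_mat)+
  then have 1: "S ** (transpose D ** D) = mat 1"  "(transpose D ** D) ** S = mat 1"
    using CD unfolding S_eq by (metis matrix_mul_assoc matrix_mul_rid)+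
  then have "invertible S" unfolding invertible_def by blast
  then show ?thesis
    unfolding Q_eq by (metis 1(2) matrix_inv(1) matrix_mul_assoc matrix_mul_lid matrix_mul_rid)
qed

lemma SQ: "S ** Q = mat 1" "Q ** S = mat 1"
proof -
  have "transpose C ** transpose D = mat 1" "transpose D ** transpose C = mat 1"
    using CD by (metis matrix_transpose_mul transpose_mat)+
  then show "S ** Q = mat 1" "Q ** S = mat 1"
    using CD unfolding S_eq Q_D by (metis matrix_mul_assoc matrix_mul_rid)+
qed

text \<open>Since \<open>Q = D\<^sup>T D\<close>, the inner product of \<open>Q\<close> is the
  Euclidean one after applying \<open>D\<close>; symmetry, positivity and the Cauchy-Schwarz
  inequality are thereby inherited.\<close>

lemma inner_Q: "x \<bullet> (Q *v y) = (D *v x) \<bullet> (D *v y)"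
  unfolding Q_D by (metis dot_lmul_matrix matrix_vector_mul_assoc transpose_matrix_vector transpose_transpose inner_commute)

lemma q_norm: "q x = (norm (D *v x))\<^sup>2"
  by (simp add: q_def inner_Q power2_norm_eq_inner)

lemma transpose_S: "transpose S = S" and transpose_Q: "transpose Q = Q"
  unfolding S_eq Q_D by (simp_all add: matrix_transpose_mul)

lemma mvn_density_0: "mvn_density 0 S x = exp (- q x / 2) / sqrt ((2 * pi) ^ CARD('m) * det S)"
  by (simp add: mvn_density_def q_def flip: Q_eq)

lemma det_S: "det S = (det C)\<^sup>2"
  by (simp add: S_eq det_mul power2_eq_square)

lemma det_C: "det C \<noteq> 0"
  using invertible_C by (simp add: invertible_det_nz)

lemma continuous_on_q [continuous_intros]: "continuous_on X q"
  unfolding q_def by (intro continuous_intros)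

text \<open>The substitution of \<open>C *v x\<close> for \<open>x\<close> turns \<open>q\<close>
  into the squared norm, and its Jacobian \<open>\<bar>det C\<bar>\<close> is the square root of
  \<open>det S\<close>.\<close>

lemma nn_integral_exp_q:
  "(\<integral>\<^sup>+x. ennreal (exp (- q x / 2)) \<partial>lborel) = ennreal (sqrt ((2 * pi) ^ CARD('m) * det S))"
proof -
  have "(\<integral>\<^sup>+x. ennreal (exp (- q x / 2)) \<partial>lborel) =
      ennreal \<bar>det (matrix ((*v) C))\<bar> * (\<integral>\<^sup>+x. ennreal (exp (- q (C *v x) / 2)) \<partial>lborel)"
    by (rule nn_integral_lborel_linear)
      (auto simp: det_C intro!: borel_measurable_continuous_onI measurable_compose[OF _ measurable_ennreal] continuous_intros)
  also have "(\<lambda>x. q (C *v x)) = (\<lambda>x. (norm x)\<^sup>2)"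
    by (simp add: q_norm matrix_vector_mul_assoc CD)
  finally show ?thesis
    unfolding nn_integral_exp_half_norm_square
    by (simp add: det_S real_sqrt_mult ennreal_mult mult.commute)
qed

lemma nn_integral_mvn_density: "(\<integral>\<^sup>+x. ennreal (mvn_density 0 S x) \<partial>lborel) = 1"
proof -
  let ?c = "sqrt ((2 * pi) ^ CARD('m) * det S)"
  have c: "?c > 0"
    using det_C by (simp add: det_S zero_less_mult_iff)
  have [measurable]: "q \<in> borel_measurable borel"
    by (intro borel_measurable_continuous_onI continuous_intros)
  have "(\<integral>\<^sup>+x. ennreal (mvn_density 0 S x) \<partial>lborel) = (\<integral>\<^sup>+x. ennreal (1 / ?c) * ennreal (exp (- q x / 2)) \<partial>lborel)"
    using c by (intro nn_integral_cong) (simp add: mvn_density_0 ennreal_mult[symmetric])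
  also have "\<dots> = ennreal (1 / ?c) * ennreal ?c"
    by (subst nn_integral_cmult) (auto simp only: nn_integral_exp_q, measurable)
  also have "\<dots> = 1"
    using c det_C by (simp add: ennreal_mult[symmetric] det_S)
  finally show ?thesis .
qed

end

subsection \<open>Gradients and integration by parts\<close>

definition pd :: "'m \<Rightarrow> (real^'m \<Rightarrow> real) \<Rightarrow> real^'m \<Rightarrow> real" where
  "pd p f x = deriv (\<lambda>t. f (x + t *\<^sub>R axis p 1)) 0"

definition grad :: "(real^'m \<Rightarrow> real) \<Rightarrow> real^'m \<Rightarrow> real^'m" where
  "grad f x = (\<chi> p. pd p f x)"

text \<open>Phrased with \<open>GDERIV\<close> so that its product and chain rules apply directly;
  \<open>C1_iff_C1_vec\<close> below identifies it with \<open>C1\<close> after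
  vectorization.\<close>

definition C1_vec :: "(real^'m \<Rightarrow> real) \<Rightarrow> bool" where
  "C1_vec f \<longleftrightarrow> (\<forall>x. GDERIV f x :> grad f x) \<and> continuous_on UNIV (grad f)"

definition C2_vec :: "(real^'m \<Rightarrow> real) \<Rightarrow> bool" where
  "C2_vec f \<longleftrightarrow> C1_vec f \<and> (\<forall>p. C1_vec (pd p f))"

lemma GDERIV_imp_DERIV_axis:
  fixes f :: "real^'m \<Rightarrow> real"
  assumes "GDERIV f (x + t *\<^sub>R axis p 1) :> g"
  shows "((\<lambda>t. f (x + t *\<^sub>R axis p 1)) has_real_derivative g $ p) (at t)"
proof -
  have "((\<lambda>t. x + t *\<^sub>R axis p 1) has_derivative (\<lambda>t. t *\<^sub>R axis p 1)) (at t)"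
    by (auto intro!: derivative_eq_intros)
  from has_derivative_compose[OF this assms[unfolded gderiv_def]]
  show ?thesis
    by (simp add: has_field_derivative_def inner_axis' mult_commute_abs)
qed

lemma pd_eq: "GDERIV f x :> g \<Longrightarrow> pd p f x = g $ p"
  using GDERIV_imp_DERIV_axis[of f x 0 p g] unfolding pd_def by (simp add: DERIV_imp_deriv)

lemma grad_eq: "GDERIV f x :> g \<Longrightarrow> grad f x = g"
  by (simp add: grad_def pd_eq vec_eq_iff)

lemma C1_vecI:
  assumes "\<And>x. GDERIV f x :> g x" "continuous_on UNIV g"
  shows "C1_vec f"
proof -
  have "grad f = g"
    using assms(1) by (auto intro: grad_eq)
  then show ?thesis
    using assms by (simp add: C1_vec_def)
qed

lemma C1_vecD:
  assumes "C1_vec f"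
  shows "GDERIV f x :> grad f x" "continuous_on X (grad f)" "continuous_on X (pd p f)" "continuous_on X f"
proof -
  have g: "GDERIV f x :> grad f x" for x
    using assms by (simp add: C1_vec_def)
  then show "GDERIV f x :> grad f x" .
  show c: "continuous_on X (grad f)"
    using assms by (auto simp: C1_vec_def intro: continuous_on_subset)
  have "pd p f = (\<lambda>x. grad f x $ p)"
    by (simp add: grad_def)
  then show "continuous_on X (pd p f)"
    using c by (auto intro: continuous_intros)
  show "continuous_on X f"
    using g by (auto simp: gderiv_def intro!: continuous_at_imp_continuous_on has_derivative_continuous)
qed

text \<open>The derivative, being a linear functional, is the inner product with the vector of its
  values on the axes, and that vector must be \<open>grad f x\<close>.\<close>

lemma differentiable_imp_GDERIV:
  fixes f :: "real^'m \<Rightarrow> real"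
  assumes "f differentiable (at x)"
  shows "GDERIV f x :> grad f x"
proof -
  obtain f' where f': "(f has_derivative f') (at x)"
    using assms by (auto simp: differentiable_def)
  then interpret f': linear f'
    by (rule has_derivative_linear)
  have "f' h = h \<bullet> (\<chi> p. f' (axis p 1))" for h
  proof -
    have "f' h = f' (\<Sum>p\<in>UNIV. h $ p *\<^sub>R axis p 1)"
      by (simp add: basis_expansion flip: scalar_mult_eq_scaleR)
    then show ?thesis
      by (simp add: f'.sum f'.scale inner_vec_def)
  qed
  then have "f' = (\<lambda>h. h \<bullet> (\<chi> p. f' (axis p 1)))"
    by blast
  with f' have "GDERIV f x :> (\<chi> p. f' (axis p 1))"
    unfolding gderiv_def by metis
  then show ?thesis
    by (simp add: grad_eq)
qed

text \<open>By translation invariance every difference quotient of \<open>g\<close> has integral 0.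
  Compact support and a bounded derivative allow dominated convergence to the partial
  derivative.\<close>

lemma integral_pd_compact_support:
  fixes g :: "real^'m \<Rightarrow> real"
  assumes g: "C1_vec g" and supp: "\<And>x. norm x > R \<Longrightarrow> g x = 0"
  shows "integrable lborel (pd p g)" "(\<integral>x. pd p g x \<partial>lborel) = 0"
proof -
  define e :: "real^'m" where "e = axis p 1"
  have ne: "norm e = 1" by (simp add: e_def)
  have cont [continuous_intros]: "continuous_on X g" "continuous_on X (pd p g)" for X
    using C1_vecD[OF g] by auto
  have [measurable]: "g \<in> borel_measurable borel" "pd p g \<in> borel_measurable borel"
    by (auto intro!: borel_measurable_continuous_onI cont)
  have pd0: "pd p g x = 0" if "norm x > R" for x
  proof -
    have "eventually (\<lambda>y. y \<in> {y. norm y > R}) (nhds x)"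
      using that by (intro eventually_nhds_in_open open_Collect_less continuous_intros) auto
    then have "eventually (\<lambda>y. g y = 0) (nhds x)"
      by eventually_elim (auto intro: supp)
    then have "(g has_derivative (\<lambda>h. 0)) (at x)"
      using supp[OF that]
      by (intro has_derivative_transform_eventually[of "\<lambda>_. 0" "\<lambda>_. 0" x UNIV g])
        (auto simp: eventually_at_filter elim!: eventually_mono)
    then have "GDERIV g x :> 0"
      by (simp add: gderiv_def)
    then show ?thesis
      by (simp add: pd_eq)
  qed
  have "bounded (pd p g ` cball 0 R)"
    by (intro compact_imp_bounded compact_continuous_image cont compact_cball)
  then obtain B0 where "\<And>x. norm x \<le> R \<Longrightarrow> \<bar>pd p g x\<bar> \<le> B0"
    unfolding bounded_iff by (metis imageI mem_cball_0 real_norm_def)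
  \<comment> \<open>The maximum with 0 covers points outside the ball, where the derivative
    vanishes, and also the case of an empty ball, where \<open>B0\<close> is arbitrary.\<close>
  then have B: "\<bar>pd p g x\<bar> \<le> max 0 B0" for x
    using pd0[of x] by (cases "norm x \<le> R") force+
  define B where "B = max 0 B0"
  have incr: "\<bar>g (x + h *\<^sub>R e) - g x\<bar> \<le> h * B" if "h > 0" for x h
  proof -
    have "\<exists>z. 0 < z \<and> z < h \<and> g (x + h *\<^sub>R e) - g (x + 0 *\<^sub>R e) = (h - 0) * grad g (x + z *\<^sub>R e) $ p"
      unfolding e_def by (rule MVT2[OF that]) (intro GDERIV_imp_DERIV_axis C1_vecD[OF g])
    then obtain z where "g (x + h *\<^sub>R e) - g x = h * pd p g (x + z *\<^sub>R e)"
      by (auto simp: grad_def)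
    then show ?thesis
      using B[of "x + z *\<^sub>R e"] that by (simp add: B_def abs_mult)
  qed
  have compact_int: "integrable lborel u"
    if "continuous_on UNIV u" "\<And>x. norm x > r \<Longrightarrow> u x = 0" for u :: "real^'m \<Rightarrow> real" and r
  proof -
    have "integrable lborel (\<lambda>x. indicator (cball 0 r) x *\<^sub>R u x)"
      by (intro borel_integrable_compact compact_cball continuous_on_subset[OF that(1)]) auto
    moreover have "(\<lambda>x. indicator (cball 0 r) x *\<^sub>R u x) = u"
      using that(2) by (force simp: indicator_def)
    ultimately show ?thesis by simp
  qed
  show int_pd: "integrable lborel (pd p g)"
    by (rule compact_int[OF cont(2) pd0])
  have int_g: "integrable lborel g"
    by (rule compact_int[OF cont(1) supp])
  define s where "s n x = real (Suc n) * (g (x + (1 / real (Suc n)) *\<^sub>R e) - g x)" for n x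
  have meas_shift: "(\<lambda>x. x + c) \<in> lborel \<rightarrow>\<^sub>M borel" for c :: "real^'m"
    by measurable
  have shift: "integrable lborel (\<lambda>x. g (x + c))" "(\<integral>x. g (x + c) \<partial>lborel) = (\<integral>x. g x \<partial>lborel)" for c
  proof -
    have d: "distr lborel borel (\<lambda>x. x + c) = lborel"
      using lborel_distr_plus[of c] unfolding add.commute[of c, abs_def] .
    show "integrable lborel (\<lambda>x. g (x + c))"
      using int_g integrable_distr_eq[OF meas_shift, of g c] by (simp add: d)
    show "(\<integral>x. g (x + c) \<partial>lborel) = (\<integral>x. g x \<partial>lborel)"
      using integral_distr[OF meas_shift, of g c] by (simp add: d)
  qed
  have "(\<integral>x. s n x \<partial>lborel) = 0" for n
    unfolding s_def using shift int_g by (simp add: Bochner_Integration.integral_diff)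
  \<comment> \<open>The step lengths are at most 1, so all quotients vanish outside the ball of
    radius \<open>R + 1\<close>; inside, the mean value bound \<open>incr\<close> controls them by
    \<open>B\<close>.\<close>
  moreover have "(\<lambda>n. \<integral>x. s n x \<partial>lborel) \<longlonglongrightarrow> (\<integral>x. pd p g x \<partial>lborel)"
  proof (rule integral_dominated_convergence[where w = "\<lambda>x. B * indicator (cball 0 (R + 1)) x"])
    show "integrable lborel (\<lambda>x::real^'m. B * indicator (cball 0 (R + 1)) x)"
      using emeasure_bounded_finite[OF bounded_cball, of "0::real^'m" "R + 1"]
      by (intro integrable_mult_right integrable_real_indicator) auto
    show "AE x in lborel. (\<lambda>n. s n x) \<longlonglongrightarrow> pd p g x"
    proof (rule AE_I2)
      fix x
      have "((\<lambda>t. g (x + t *\<^sub>R e)) has_real_derivative pd p g x) (at 0)"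
        using GDERIV_imp_DERIV_axis[of g x 0 p "grad g x"] C1_vecD(1)[OF g] by (simp add: e_def grad_def)
      then have "((\<lambda>h. (g (x + h *\<^sub>R e) - g x) / h) \<longlongrightarrow> pd p g x) (at 0)"
        by (simp add: has_field_derivative_iff)
      moreover have "filterlim (\<lambda>n. 1 / real (Suc n)) (at 0) sequentially"
        by (auto simp: filterlim_at lim_1_over_n LIMSEQ_Suc[OF lim_1_over_n, simplified])
      ultimately have "((\<lambda>n. (g (x + (1 / real (Suc n)) *\<^sub>R e) - g x) / (1 / real (Suc n))) \<longlongrightarrow> pd p g x) sequentially"
        by (rule filterlim_compose)
      then show "(\<lambda>n. s n x) \<longlonglongrightarrow> pd p g x"
        by (simp add: s_def mult.commute)
    qed
    show "AE x in lborel. norm (s n x) \<le> B * indicator (cball 0 (R + 1)) x" for n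
    proof (rule AE_I2)
      fix x
      let ?h = "1 / real (Suc n)"
      show "norm (s n x) \<le> B * indicator (cball 0 (R + 1)) x"
      proof (cases "norm x \<le> R + 1")
        case True
        have "real (Suc n) * \<bar>g (x + ?h *\<^sub>R e) - g x\<bar> \<le> real (Suc n) * (?h * B)"
          by (intro mult_left_mono incr) auto
        with True show ?thesis
          by (simp add: s_def abs_mult)
      next
        case False
        have "norm x \<le> norm (x + ?h *\<^sub>R e) + norm (?h *\<^sub>R e)"
          by (metis add_diff_cancel norm_triangle_ineq4)
        moreover have "norm (?h *\<^sub>R e) \<le> 1"
          by (simp add: ne)
        ultimately have "norm (x + ?h *\<^sub>R e) > R"
          using False by linarith
        with False show ?thesis
          by (simp add: s_def supp)
      qed
    qed
  qed (auto simp: s_def)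
  ultimately show "(\<integral>x. pd p g x \<partial>lborel) = 0"
    by (simp add: LIMSEQ_const_iff)
qed

subsection \<open>The Stein identity for the normal distribution\<close>

definition drift :: "(real^'m \<Rightarrow> real) \<Rightarrow> real^'m \<Rightarrow> real" where
  "drift f x = x \<bullet> grad f x"

definition diffusion :: "real^'m^'m \<Rightarrow> (real^'m \<Rightarrow> real) \<Rightarrow> real^'m \<Rightarrow> real" where
  "diffusion S f x = (\<Sum>p\<in>UNIV. \<Sum>r\<in>UNIV. S $ p $ r * pd p (pd r f) x)"

lemma continuous_on_drift: "C2_vec f \<Longrightarrow> continuous_on X (drift f)"
  unfolding drift_def C2_vec_def by (intro continuous_intros) (auto intro: C1_vecD)

lemma continuous_on_diffusion: "C2_vec f \<Longrightarrow> continuous_on X (diffusion S f)"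
  unfolding diffusion_def C2_vec_def by (intro continuous_intros) (auto intro: C1_vecD)

text \<open>Squaring the positive part smooths its kink: at 0 the difference quotient is at most
  \<open>\<bar>h\<bar>\<close> in absolute value. This supplies a continuously differentiable
  cutoff.\<close>

lemma has_real_derivative_max_0_square:
  "((\<lambda>s. (max 0 s)\<^sup>2) has_real_derivative 2 * max 0 s) (at (s::real))"
proof -
  consider "s > 0" | "s < 0" | "s = 0" by linarith
  then show ?thesis
  proof cases
    case 1
    have "((\<lambda>s::real. s\<^sup>2) has_real_derivative 2 * max 0 s) (at s)"
      using 1 by (auto intro!: derivative_eq_intros)
    then show ?thesis
      by (rule has_field_derivative_transform_within_open[where S = "{0<..}"]) (use 1 in auto)
  next
    case 2
    have "((\<lambda>s::real. 0) has_real_derivative 2 * max 0 s) (at s)"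
      using 2 by (auto intro!: derivative_eq_intros)
    then show ?thesis
      by (rule has_field_derivative_transform_within_open[where S = "{..<0}"]) (use 2 in auto)
  next
    case 3
    have "((\<lambda>h::real. (max 0 h)\<^sup>2 / h) \<longlongrightarrow> 0) (at 0)"
    proof (rule Lim_null_comparison)
      show "\<forall>\<^sub>F h in at 0. norm ((max 0 h)\<^sup>2 / h :: real) \<le> \<bar>h\<bar>"
        by (intro always_eventually) (auto simp: max_def power2_eq_square)
      show "((\<lambda>h::real. \<bar>h\<bar>) \<longlongrightarrow> 0) (at 0)"
        using tendsto_rabs[OF tendsto_ident_at, of 0 UNIV] by simp
    qed
    then show ?thesis
      by (simp add: 3 has_field_derivative_iff)
  qed
qed

context gaussian_factor
begin

lemma GDERIV_q: "GDERIV q x :> 2 *\<^sub>R (Q *v x)"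
proof -
  have "(q has_derivative (\<lambda>h. x \<bullet> (Q *v h) + h \<bullet> (Q *v x))) (at x)"
    unfolding q_def
    by (intro has_derivative_inner has_derivative_ident
        bounded_linear.has_derivative[OF matrix_vector_mul_bounded_linear])
  also have "(\<lambda>h. x \<bullet> (Q *v h) + h \<bullet> (Q *v x)) = (\<lambda>h. h \<bullet> (2 *\<^sub>R (Q *v x)))"
    by (simp add: fun_eq_iff inner_Q inner_commute)
  finally show ?thesis
    by (simp add: gderiv_def)
qed

text \<open>From \<open>x = C *v (D *v x)\<close>. Sublevel sets of \<open>q\<close> are therefore
  bounded, and a cutoff in \<open>q\<close> has compact support.\<close>

lemma norm_le_q: "(norm x)\<^sup>2 \<le> (onorm ((*v) C))\<^sup>2 * q x"
proof -
  have "x = C *v (D *v x)"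
    by (simp add: matrix_vector_mul_assoc CD)
  then have "norm x \<le> onorm ((*v) C) * norm (D *v x)"
    using onorm[OF matrix_vector_mul_bounded_linear[of C], of "D *v x"] by simp
  then have "(norm x)\<^sup>2 \<le> (onorm ((*v) C) * norm (D *v x))\<^sup>2"
    by (intro power_mono) auto
  then show ?thesis
    by (simp add: q_norm power_mult_distrib)
qed

lemma q_nonneg: "q x \<ge> 0"
  by (simp add: q_norm)

text \<open>The integrand is the divergence of \<open>\<psi> (q x)\<close> times
  \<open>S *v grad f x\<close>. Differentiating the weight produces \<open>2 Q x\<close>, and
  \<open>S Q = 1\<close> contracts this with the gradient to the radial derivative
  \<open>drift f\<close>.\<close>

lemma integral_by_parts_radial:
  assumes f: "C2_vec f"
    and \<psi>: "\<And>s. (\<psi> has_real_derivative \<psi>' s) (at s)" "continuous_on UNIV \<psi>'"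
    and supp: "\<And>s. s \<ge> r \<Longrightarrow> \<psi> s = 0"
  shows "(\<integral>x. \<psi> (q x) * diffusion S f x + 2 * \<psi>' (q x) * drift f x \<partial>lborel) = 0"
proof -
  have c\<psi>: "continuous_on UNIV \<psi>"
    using \<psi>(1) DERIV_isCont by (blast intro: continuous_at_imp_continuous_on)
  define k where "k l = (\<lambda>x. \<psi> (q x) * pd l f x)" for l
  define k' where "k' l = (\<lambda>x. \<psi> (q x) *\<^sub>R grad (pd l f) x + pd l f x *\<^sub>R (\<psi>' (q x) *\<^sub>R (2 *\<^sub>R (Q *v x))))" for l
  have gk: "GDERIV (k l) x :> k' l x" for l x
    unfolding k_def k'_def
    by (rule GDERIV_mult GDERIV_DERIV_compose GDERIV_q \<psi> C1_vecD)+ (use f in \<open>simp add: C2_vec_def\<close>)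
  have k: "C1_vec (k l)" for l
  proof (rule C1_vecI[OF gk])
    show "continuous_on UNIV (k' l)"
      unfolding k'_def using f
      by (intro continuous_intros C1_vecD continuous_on_compose2[OF c\<psi>] continuous_on_compose2[OF \<psi>(2)])
        (auto simp: C2_vec_def)
  qed
  \<comment> \<open>The radius comes from \<open>norm_le_q\<close>: beyond it \<open>q x\<close>
    exceeds \<open>r\<close>. The maximum with 0 admits negative \<open>r\<close>.\<close>
  have sk: "k l x = 0" if "norm x > onorm ((*v) C) * sqrt (max 0 r)" for l x
  proof -
    have "(onorm ((*v) C) * sqrt (max 0 r))\<^sup>2 < (norm x)\<^sup>2"
      using that by (intro power_strict_mono) (auto intro!: mult_nonneg_nonneg onorm_pos_le matrix_vector_mul_bounded_linear)
    with norm_le_q[of x] have "(onorm ((*v) C))\<^sup>2 * max 0 r < (onorm ((*v) C))\<^sup>2 * q x"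
      by (simp add: power_mult_distrib)
    then have "r < q x"
      by (auto simp: mult_less_cancel_left)
    then show ?thesis
      by (simp add: k_def supp)
  qed
  note int = integral_pd_compact_support[OF k sk]
  have pdk: "pd p (k l) x = \<psi> (q x) * pd p (pd l f) x + 2 * \<psi>' (q x) * pd l f x * (Q *v x) $ p" for p l x
    using pd_eq[OF gk, of p l x] by (simp add: k'_def grad_def)
  have "(\<Sum>p\<in>UNIV. \<Sum>l\<in>UNIV. S $ p $ l * (Q *v x) $ p * pd l f x) = drift f x" for x
  proof -
    have "(\<Sum>p\<in>UNIV. \<Sum>l\<in>UNIV. S $ p $ l * (Q *v x) $ p * pd l f x) =
        (\<Sum>l\<in>UNIV. (transpose S *v (Q *v x)) $ l * pd l f x)"
      by (subst sum.swap) (simp add: matrix_vector_mult_def transpose_def sum_distrib_right)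
    also have "transpose S *v (Q *v x) = x"
      by (simp add: transpose_S matrix_vector_mul_assoc SQ)
    finally show ?thesis
      by (simp add: drift_def inner_vec_def grad_def)
  qed
  then have "\<psi> (q x) * diffusion S f x + 2 * \<psi>' (q x) * drift f x =
      \<psi> (q x) * diffusion S f x + 2 * \<psi>' (q x) * (\<Sum>p\<in>UNIV. \<Sum>l\<in>UNIV. S $ p $ l * (Q *v x) $ p * pd l f x)" for x
    by simp
  also have "\<dots>x = (\<Sum>p\<in>UNIV. \<Sum>l\<in>UNIV. S $ p $ l * pd p (k l) x)" for x
    by (simp add: diffusion_def pdk sum_distrib_left algebra_simps flip: sum.distrib)
  finally have "(\<lambda>x. \<psi> (q x) * diffusion S f x + 2 * \<psi>' (q x) * drift f x) =
      (\<lambda>x. \<Sum>p\<in>UNIV. \<Sum>l\<in>UNIV. S $ p $ l * pd p (k l) x)"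
    by blast
  then show ?thesis
    by (simp add: int Bochner_Integration.integral_sum)
qed

lemma stein_identity_of_density:
  assumes Y: "distributed M lborel Y (\<lambda>x. ennreal (mvn_density 0 S x))"
    and f: "C2_vec f"
    and int: "integrable M (\<lambda>\<omega>. drift f (Y \<omega>))" "integrable M (\<lambda>\<omega>. diffusion S f (Y \<omega>))"
  shows "(\<integral>\<omega>. - drift f (Y \<omega>) + diffusion S f (Y \<omega>) \<partial>M) = 0"
proof -
  define \<phi> where "\<phi> = mvn_density 0 S"
  define c where "c = 1 / sqrt ((2 * pi) ^ CARD('m) * det S)"
  have \<phi>: "\<phi> x = c * exp (- q x / 2)" for x
    by (simp add: \<phi>_def c_def mvn_density_0)
  have c: "c \<ge> 0"
    by (simp add: c_def det_S)
  have nn: "\<phi> x \<ge> 0" for x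
    using c by (simp add: \<phi>)
  have [measurable]: "\<phi> \<in> borel_measurable borel" "drift f \<in> borel_measurable borel"
      "diffusion S f \<in> borel_measurable borel" "q \<in> borel_measurable borel"
    unfolding \<phi> by (auto intro!: borel_measurable_continuous_onI continuous_intros
        continuous_on_drift continuous_on_diffusion f simp: \<phi>[abs_def])
  note Y' = Y[folded \<phi>_def]
  have i: "integrable lborel (\<lambda>x. \<phi> x * drift f x)" "integrable lborel (\<lambda>x. \<phi> x * diffusion S f x)"
    using int distributed_integrable[OF Y', of "drift f"] distributed_integrable[OF Y', of "diffusion S f"]
    by (auto simp: nn)
  define R where "R n = real (Suc n)" for n
  have R: "R n \<ge> 1" "R n \<noteq> 0" for n by (auto simp: R_def)
  \<comment> \<open>The squared positive part of \<open>1 - s / R n\<close>: it vanishes for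
    \<open>s \<ge> R n\<close>, tends to 1 pointwise, and for \<open>s \<ge> 0\<close> its
    derivative is at most \<open>2 / R n\<close> in absolute value.\<close>
  define \<eta> where "\<eta> n s = (max 0 (1 - s / R n))\<^sup>2" for n s
  define \<eta>' where "\<eta>' n s = - 2 / R n * max 0 (1 - s / R n)" for n s
  have d\<eta>: "(\<eta> n has_real_derivative \<eta>' n s) (at s)" for n s
    unfolding \<eta>_def \<eta>'_def
    by (rule DERIV_chain2[OF has_real_derivative_max_0_square, THEN DERIV_cong])
      (auto intro!: derivative_eq_intros simp: R)
  define \<psi> where "\<psi> n s = c * exp (- s / 2) * \<eta> n s" for n s
  define \<psi>' where "\<psi>' n s = c * exp (- s / 2) * (\<eta>' n s - \<eta> n s / 2)" for n s
  have d\<psi>: "(\<psi> n has_real_derivative \<psi>' n s) (at s)" for n s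
    unfolding \<psi>_def \<psi>'_def
    by (auto intro!: derivative_eq_intros d\<eta> simp: algebra_simps)
  have c\<psi>': "continuous_on UNIV (\<psi>' n)" for n
    using R(1)[of n] unfolding \<psi>'_def \<eta>_def \<eta>'_def by (intro continuous_intros) auto
  have supp: "\<psi> n s = 0" if "s \<ge> R n" for n s
    using that R(1)[of n] by (simp add: \<psi>_def \<eta>_def max_def field_simps)
  define s where "s n x = \<psi> n (q x) * diffusion S f x + 2 * \<psi>' n (q x) * drift f x" for n x
  \<comment> \<open>The factor \<open>exp (- s / 2)\<close> of the weight differentiates to the term
    \<open>- drift f\<close>; what remains beside the cut-off generator is an error containing
    \<open>\<eta>'\<close>.\<close>
  have s_eq: "s n x = \<phi> x * (\<eta> n (q x) * (diffusion S f x - drift f x) + 2 * \<eta>' n (q x) * drift f x)" for n x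
    by (simp add: s_def \<phi> \<psi>_def \<psi>'_def algebra_simps)
  have \<eta>_bd: "0 \<le> \<eta> n (q x)" "\<eta> n (q x) \<le> 1" "\<bar>\<eta>' n (q x)\<bar> \<le> 2 / R n" for n x
  proof -
    have "0 \<le> q x / R n"
      using q_nonneg[of x] R(1)[of n] by simp
    then have m: "0 \<le> max 0 (1 - q x / R n)" "max 0 (1 - q x / R n) \<le> 1"
      by auto
    then show "0 \<le> \<eta> n (q x)" "\<eta> n (q x) \<le> 1"
      by (auto simp: \<eta>_def power_le_one)
    have "2 / R n * max 0 (1 - q x / R n) \<le> 2 / R n * 1"
      using m R(1)[of n] by (intro mult_left_mono) auto
    then show "\<bar>\<eta>' n (q x)\<bar> \<le> 2 / R n"
      using m R(1)[of n] by (simp add: \<eta>'_def abs_mult)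
  qed
  have R_lim: "(\<lambda>n. a / R n) \<longlonglongrightarrow> 0" for a
    using LIMSEQ_Suc[OF lim_const_over_n[of a]] by (simp add: R_def)
  have "(\<integral>x. s n x \<partial>lborel) = 0" for n
    unfolding s_def by (rule integral_by_parts_radial[OF f d\<psi> c\<psi>' supp])
  moreover have "(\<lambda>n. \<integral>x. s n x \<partial>lborel) \<longlonglongrightarrow> (\<integral>x. \<phi> x * (diffusion S f x - drift f x) \<partial>lborel)"
  \<comment> \<open>The cutoff lies between 0 and 1, and \<open>R n \<ge> 1\<close> makes
    \<open>2 * \<eta>' n (q x)\<close> at most 4 in absolute value; hence the factor
    \<open>5 = 1 + 4\<close> at the drift.\<close>
  proof (rule integral_dominated_convergence[where w = "\<lambda>x. \<bar>\<phi> x * diffusion S f x\<bar> + 5 * \<bar>\<phi> x * drift f x\<bar>"])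
    show "(\<lambda>x. \<phi> x * (diffusion S f x - drift f x)) \<in> borel_measurable lborel"
      by measurable
    show "s n \<in> borel_measurable lborel" for n
      unfolding s_eq[abs_def] \<eta>_def \<eta>'_def by measurable
    show "integrable lborel (\<lambda>x. \<bar>\<phi> x * diffusion S f x\<bar> + 5 * \<bar>\<phi> x * drift f x\<bar>)"
      using i by auto
    show "AE x in lborel. (\<lambda>n. s n x) \<longlonglongrightarrow> \<phi> x * (diffusion S f x - drift f x)"
    proof (rule AE_I2)
      fix x
      have "(\<lambda>n. \<eta> n (q x)) \<longlonglongrightarrow> (max 0 (1 - 0))\<^sup>2" "(\<lambda>n. \<eta>' n (q x)) \<longlonglongrightarrow> 0 * max 0 (1 - 0)"
        unfolding \<eta>_def \<eta>'_def using R_lim[of "-2"] by (intro tendsto_intros R_lim; simp)+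
      then have "(\<lambda>n. s n x) \<longlonglongrightarrow> \<phi> x * (1 * (diffusion S f x - drift f x) + 2 * 0 * drift f x)"
        unfolding s_eq by (intro tendsto_intros) auto
      then show "(\<lambda>n. s n x) \<longlonglongrightarrow> \<phi> x * (diffusion S f x - drift f x)"
        by simp
    qed
    show "AE x in lborel. norm (s n x) \<le> \<bar>\<phi> x * diffusion S f x\<bar> + 5 * \<bar>\<phi> x * drift f x\<bar>" for n
    proof (rule AE_I2)
      fix x
      have "2 / R n \<le> 2"
        using R(1)[of n] by (simp add: field_simps)
      with \<eta>_bd[of n x] have b: "\<bar>\<eta> n (q x)\<bar> \<le> 1" "\<bar>2 * \<eta>' n (q x)\<bar> \<le> 4"
        by auto
      have "\<bar>\<eta> n (q x) * (diffusion S f x - drift f x) + 2 * \<eta>' n (q x) * drift f x\<bar>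
          \<le> \<bar>\<eta> n (q x)\<bar> * \<bar>diffusion S f x - drift f x\<bar> + \<bar>2 * \<eta>' n (q x)\<bar> * \<bar>drift f x\<bar>"
        by (simp add: abs_triangle_ineq flip: abs_mult)
      also have "\<dots> \<le> 1 * \<bar>diffusion S f x - drift f x\<bar> + 4 * \<bar>drift f x\<bar>"
        using b by (intro add_mono mult_right_mono) auto
      also have "\<dots> \<le> \<bar>diffusion S f x\<bar> + 5 * \<bar>drift f x\<bar>"
        using abs_triangle_ineq4[of "diffusion S f x" "drift f x"] by simp
      finally have "\<phi> x * \<bar>\<eta> n (q x) * (diffusion S f x - drift f x) + 2 * \<eta>' n (q x) * drift f x\<bar>
          \<le> \<phi> x * (\<bar>diffusion S f x\<bar> + 5 * \<bar>drift f x\<bar>)"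
        using nn by (rule mult_left_mono)
      also have "\<dots> = \<bar>\<phi> x * diffusion S f x\<bar> + 5 * \<bar>\<phi> x * drift f x\<bar>"
        by (simp add: abs_mult nn distrib_left)
      finally show "norm (s n x) \<le> \<bar>\<phi> x * diffusion S f x\<bar> + 5 * \<bar>\<phi> x * drift f x\<bar>"
        by (simp add: s_eq abs_mult nn)
    qed
  qed
  ultimately have "(\<integral>x. \<phi> x * (diffusion S f x - drift f x) \<partial>lborel) = 0"
    by (simp add: LIMSEQ_const_iff)
  then show ?thesis
    using distributed_integral[OF Y', of "\<lambda>x. diffusion S f x - drift f x"] by (simp add: nn)
qed

end

subsection \<open>The Ornstein-Uhlenbeck flow of Gaussian bumps\<close>

context gaussian_factor
begin

lemma q_scaleR: "q (c *\<^sub>R x) = c\<^sup>2 * q x"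
  by (simp add: q_norm matrix_vector_mult_scaleR power_mult_distrib)

lemma trace_SQ: "(\<Sum>p\<in>UNIV. \<Sum>l\<in>UNIV. S $ p $ l * Q $ p $ l) = CARD('m)"
proof -
  have "(\<Sum>p\<in>UNIV. \<Sum>l\<in>UNIV. S $ p $ l * Q $ p $ l) = trace (S ** transpose Q)"
    by (simp add: trace_def matrix_matrix_mult_def transpose_def)
  then show ?thesis
    by (simp add: transpose_Q SQ trace_def mat_def)
qed

lemma sum_S_Q: "(\<Sum>p\<in>UNIV. \<Sum>l\<in>UNIV. S $ p $ l * ((Q *v y) $ p * (Q *v y) $ l)) = q y"
proof -
  have "(\<Sum>p\<in>UNIV. \<Sum>l\<in>UNIV. S $ p $ l * ((Q *v y) $ p * (Q *v y) $ l)) = (Q *v y) \<bullet> (S *v (Q *v y))"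
    by (simp add: inner_vec_def matrix_vector_mult_def sum_distrib_left mult_ac)
  then show ?thesis
    by (simp add: matrix_vector_mul_assoc SQ q_def inner_commute)
qed

text \<open>For \<open>r \<noteq> 0\<close> a Gaussian profile centred at \<open>a / r\<close>.
  Writing it through \<open>a - r *\<^sub>R x\<close> includes \<open>r = 0\<close>, the limit of
  infinite time, where it is constant in \<open>x\<close>.\<close>

definition bump :: "real \<Rightarrow> real \<Rightarrow> real^'m \<Rightarrow> real \<Rightarrow> real^'m \<Rightarrow> real" where
  "bump \<kappa> w a r x = \<kappa> * exp (- q (a - r *\<^sub>R x) / (2 * w))"

lemma GDERIV_bump:
  "GDERIV (bump \<kappa> w a r) x :> (bump \<kappa> w a r x * (r / w)) *\<^sub>R (Q *v (a - r *\<^sub>R x))"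
proof -
  have "((\<lambda>x. a - r *\<^sub>R x) has_derivative (\<lambda>h. - (r *\<^sub>R h))) (at x)"
    by (auto intro!: derivative_eq_intros)
  from has_derivative_compose[OF this GDERIV_q[of "a - r *\<^sub>R x", unfolded gderiv_def]]
  have q: "GDERIV (\<lambda>x. q (a - r *\<^sub>R x)) x :> (- 2 * r) *\<^sub>R (Q *v (a - r *\<^sub>R x))"
    by (simp add: gderiv_def inner_scaleR_right mult_ac)
  have e: "((\<lambda>s. \<kappa> * exp (- s / (2 * w))) has_real_derivative
      \<kappa> * (exp (- s / (2 * w)) * (- 1 / (2 * w)))) (at s)" for s
    unfolding divide_inverse by (auto intro!: derivative_eq_intros)
  show ?thesis
    unfolding bump_def by (rule GDERIV_subst[OF GDERIV_DERIV_compose[OF q e]]) (simp add: mult_ac)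
qed

lemma continuous_on_bump [continuous_intros]: "continuous_on X (bump \<kappa> w a r)"
  unfolding bump_def[abs_def]
  by (cases "w = 0") (auto intro!: continuous_intros continuous_on_compose2[OF continuous_on_q[of UNIV]])

lemma pd_bump: "pd l (bump \<kappa> w a r) x = bump \<kappa> w a r x * (r / w) * (Q *v (a - r *\<^sub>R x)) $ l"
  using pd_eq[OF GDERIV_bump] by simp

lemma GDERIV_pd_bump:
  "GDERIV (pd l (bump \<kappa> w a r)) x :>
    (bump \<kappa> w a r x * (r / w)\<^sup>2 * (Q *v (a - r *\<^sub>R x)) $ l) *\<^sub>R (Q *v (a - r *\<^sub>R x)) -
    (bump \<kappa> w a r x * r\<^sup>2 / w) *\<^sub>R row l Q"
proof -
  have l: "GDERIV (\<lambda>x. (Q *v (a - r *\<^sub>R x)) $ l) x :> (- r) *\<^sub>R row l Q"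
    unfolding gderiv_def matrix_vector_mul_component
    by (auto intro!: derivative_eq_intros simp: row_def vec_lambda_eta inner_commute)
  have b: "GDERIV (\<lambda>x. bump \<kappa> w a r x * (r / w)) x :>
      (r / w) *\<^sub>R (bump \<kappa> w a r x * (r / w)) *\<^sub>R (Q *v (a - r *\<^sub>R x))"
    by (rule GDERIV_subst[OF GDERIV_mult[OF GDERIV_bump GDERIV_const]]) simp
  show ?thesis
    unfolding pd_bump[abs_def]
    by (rule GDERIV_subst[OF GDERIV_mult[OF b l]]) (simp add: power2_eq_square mult_ac)
qed

lemma C2_vec_bump: "C2_vec (bump \<kappa> w a r)"
  unfolding C2_vec_def
proof (intro conjI allI)
  show "C1_vec (bump \<kappa> w a r)"
    by (rule C1_vecI[OF GDERIV_bump], simp only: divide_inverse)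
      (intro continuous_intros linear_continuous_on_compose[OF _ matrix_vector_mul_linear])
  show "C1_vec (pd l (bump \<kappa> w a r))" for l
    by (rule C1_vecI[OF GDERIV_pd_bump], simp only: divide_inverse)
      (intro continuous_intros linear_continuous_on_compose[OF _ matrix_vector_mul_linear])
qed

lemma drift_bump:
  "drift (bump \<kappa> w a r) x = bump \<kappa> w a r x * (r / w) * (x \<bullet> (Q *v (a - r *\<^sub>R x)))"
  unfolding drift_def grad_eq[OF GDERIV_bump] by simp

text \<open>With \<open>y = a - r *\<^sub>R x\<close>, the Hessian combines the rank-one matrix of
  \<open>Q *v y\<close> with \<open>Q\<close> itself. Contraction with \<open>S\<close> gives
  \<open>q y\<close> for the former by \<open>sum_S_Q\<close> and the dimension for the latter by
  \<open>trace_SQ\<close>.\<close>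

lemma diffusion_bump:
  "diffusion S (bump \<kappa> w a r) x =
    bump \<kappa> w a r x * ((r / w)\<^sup>2 * q (a - r *\<^sub>R x) - r\<^sup>2 / w * real CARD('m))"
proof -
  let ?y = "a - r *\<^sub>R x" and ?B = "bump \<kappa> w a r x"
  have "Q $ p $ l = Q $ l $ p" for p l
    using transpose_Q by (metis transpose_def vec_lambda_beta)
  then have "diffusion S (bump \<kappa> w a r) x =
      (\<Sum>p\<in>UNIV. \<Sum>l\<in>UNIV. ?B * (r / w)\<^sup>2 * (S $ p $ l * ((Q *v ?y) $ p * (Q *v ?y) $ l)) -
        ?B * r\<^sup>2 / w * (S $ p $ l * Q $ p $ l))"
    unfolding diffusion_def pd_eq[OF GDERIV_pd_bump]
    by (intro sum.cong refl) (simp add: row_def algebra_simps)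
  also have "\<dots> = ?B * (r / w)\<^sup>2 * q ?y - ?B * r\<^sup>2 / w * real CARD('m)"
    unfolding sum_subtractf sum_distrib_left[symmetric] sum_S_Q trace_SQ ..
  finally show ?thesis
    by (simp add: algebra_simps)
qed

text \<open>The first two bounds come from \<open>q y \<ge> 0\<close> and
  \<open>t \<le> exp t\<close>. For the third, \<open>r *\<^sub>R x = a - y\<close> trades the
  unbounded factor \<open>x\<close> for \<open>y\<close>, whose growth the exponential
  absorbs.\<close>

lemma exp_q_bounds:
  assumes "w > 0" "r > 0"
  shows "exp (- q y / (2 * w)) \<le> 1" "q y * exp (- q y / (2 * w)) \<le> 2 * w"
    "\<bar>x \<bullet> (Q *v (a - r *\<^sub>R x))\<bar> * exp (- q (a - r *\<^sub>R x) / (2 * w)) \<le> (norm (D *v a) * (1 + 2 * w) + 2 * w) / r"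
proof -
  show 1: "exp (- q y / (2 * w)) \<le> 1" for y
    using assms q_nonneg[of y] by simp
  show 2: "q y * exp (- q y / (2 * w)) \<le> 2 * w" for y
  proof -
    have "q y / (2 * w) \<le> exp (q y / (2 * w))"
      using exp_ge_add_one_self[of "q y / (2 * w)"] by linarith
    then have "q y \<le> 2 * w * exp (q y / (2 * w))"
      using assms by (simp add: field_simps)
    then have "q y * exp (- q y / (2 * w)) \<le> 2 * w * exp (q y / (2 * w)) * exp (- q y / (2 * w))"
      by (rule mult_right_mono) simp
    also have "\<dots> = 2 * w * (exp (q y / (2 * w)) * exp (- q y / (2 * w)))"
      by (simp only: mult.assoc)
    also have "exp (q y / (2 * w)) * exp (- q y / (2 * w)) = 1"
      by (simp flip: exp_add)
    finally show ?thesis by simp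
  qed
  define y where "y = a - r *\<^sub>R x"
  let ?E = "exp (- q y / (2 * w))"
  have x: "x = (1 / r) *\<^sub>R (a - y)"
    using assms by (simp add: y_def)
  have "r * (x \<bullet> (Q *v y)) = (a - y) \<bullet> (Q *v y)"
    using assms by (subst x) simp
  also have "\<dots> = (D *v a) \<bullet> (D *v y) - q y"
    by (simp add: inner_diff_left inner_Q q_norm power2_norm_eq_inner matrix_vector_mult_diff_distrib)
  finally have "\<bar>r * (x \<bullet> (Q *v y))\<bar> \<le> \<bar>(D *v a) \<bullet> (D *v y)\<bar> + q y"
    using q_nonneg[of y] by linarith
  also have "\<bar>(D *v a) \<bullet> (D *v y)\<bar> \<le> norm (D *v a) * norm (D *v y)"
    by (rule Cauchy_Schwarz_ineq2)
  also have "norm (D *v y) \<le> 1 + q y"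
  proof -
    have "0 \<le> (norm (D *v y) - 1)\<^sup>2" by simp
    also have "\<dots> = q y - 2 * norm (D *v y) + 1"
      by (simp add: q_norm power2_diff)
    finally show ?thesis using q_nonneg[of y] by linarith
  qed
  finally have "\<bar>r * (x \<bullet> (Q *v y))\<bar> \<le> norm (D *v a) * (1 + q y) + q y"
    by (simp add: mult_left_mono)
  then have "\<bar>r * (x \<bullet> (Q *v y))\<bar> * ?E \<le> (norm (D *v a) * (1 + q y) + q y) * ?E"
    by (rule mult_right_mono) simp
  also have "\<dots> = norm (D *v a) * (?E + q y * ?E) + q y * ?E"
    by (simp add: algebra_simps)
  also have "\<dots> \<le> norm (D *v a) * (1 + 2 * w) + 2 * w"
    by (intro add_mono mult_left_mono 1 2) auto
  finally show "\<bar>x \<bullet> (Q *v (a - r *\<^sub>R x))\<bar> * exp (- q (a - r *\<^sub>R x) / (2 * w)) \<le>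
      (norm (D *v a) * (1 + 2 * w) + 2 * w) / r"
    unfolding y_def[symmetric] using assms by (simp add: abs_mult field_simps)
qed

text \<open>
  Up to normalization, \<open>mehler v a r x\<close> is the density at \<open>a\<close> of the Ornstein-Uhlenbeck process started
  at \<open>x\<close> and stopped at time \<open>- ln r\<close>, with additional Gaussian noise of covariance \<open>v S\<close>. It solves
  the backward equation, here in the form \<open>r \<partial>\<^sub>r u = drift u - diffusion S u\<close>.
\<close>

definition mehler :: "real \<Rightarrow> real^'m \<Rightarrow> real \<Rightarrow> real^'m \<Rightarrow> real" where
  "mehler v a r = bump ((v + 1 - r\<^sup>2) powr (- (real CARD('m) / 2))) (v + 1 - r\<^sup>2) a r"

text \<open>The derivative of \<open>mehler\<close> in \<open>r\<close>; the three summands stem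
  from the normalizing power, the argument \<open>a - r *\<^sub>R x\<close>, and the width in the
  exponent.\<close>

definition mehler' :: "real \<Rightarrow> real^'m \<Rightarrow> real \<Rightarrow> real^'m \<Rightarrow> real" where
  "mehler' v a r x = mehler v a r x *
    (real CARD('m) * r / (v + 1 - r\<^sup>2) + (x \<bullet> (Q *v (a - r *\<^sub>R x))) / (v + 1 - r\<^sup>2)
      - r * q (a - r *\<^sub>R x) / (v + 1 - r\<^sup>2)\<^sup>2)"

text \<open>This links flow and generator: once the Stein identity applies to
  \<open>mehler v a r\<close> with \<open>r \<noteq> 0\<close>, the expectation of
  \<open>mehler' v a r\<close> is 0.\<close>

lemma mehler_backward:
  "r * mehler' v a r x = drift (mehler v a r) x - diffusion S (mehler v a r) x"
  unfolding mehler'_def mehler_def drift_bump diffusion_bump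
  by (simp add: algebra_simps power2_eq_square)

lemma width_pos:
  fixes v r :: real
  assumes "v > 0" "\<bar>r\<bar> \<le> 1"
  shows "v \<le> v + 1 - r\<^sup>2" "v + 1 - r\<^sup>2 \<le> v + 1" "v + 1 - r\<^sup>2 > 0"
proof -
  have "r\<^sup>2 \<le> 1"
    using assms(2) by (simp add: abs_square_le_1)
  then show "v \<le> v + 1 - r\<^sup>2" "v + 1 - r\<^sup>2 \<le> v + 1" "v + 1 - r\<^sup>2 > 0"
    using assms(1) by auto
qed

lemma DERIV_mehler:
  assumes "v > 0" "\<bar>r\<bar> \<le> 1"
  shows "((\<lambda>r. mehler v a r x) has_real_derivative mehler' v a r x) (at r)"
proof -
  let ?w = "\<lambda>r::real. v + 1 - r\<^sup>2" and ?n = "real CARD('m)"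
  have w: "?w r > 0" using width_pos[OF assms] by simp
  have dw: "(?w has_real_derivative - 2 * r) (at r)"
    by (auto intro!: derivative_eq_intros)
  have "((\<lambda>r. a - r *\<^sub>R x) has_derivative (\<lambda>h. - (h *\<^sub>R x))) (at r)"
    by (auto intro!: derivative_eq_intros)
  from has_derivative_compose[OF this GDERIV_q[of "a - r *\<^sub>R x", unfolded gderiv_def]]
  have "((\<lambda>r. q (a - r *\<^sub>R x)) has_derivative (\<lambda>h. h * (- 2 * (x \<bullet> (Q *v (a - r *\<^sub>R x)))))) (at r)"
    by (rule has_derivative_eq_rhs) (simp add: fun_eq_iff)
  then have dq: "((\<lambda>r. q (a - r *\<^sub>R x)) has_real_derivative - 2 * (x \<bullet> (Q *v (a - r *\<^sub>R x)))) (at r)"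
    unfolding has_field_derivative_def by (rule has_derivative_eq_rhs) (simp add: fun_eq_iff)
  have dp: "((\<lambda>r. ?w r powr (- (?n / 2))) has_real_derivative
      ?w r powr (- (?n / 2)) * (?n * r / ?w r)) (at r)"
  proof (rule DERIV_cong[OF DERIV_fun_powr[OF dw w]])
    have "?w r powr (- (?n / 2) - of_nat 1) = ?w r powr (- (?n / 2)) / ?w r"
      using w by (subst powr_diff) simp
    moreover have "- (n / 2) * (P / W) * (- 2 * r) = P * (n * r / W)" for n P W :: real
      by simp
    ultimately show "- (?n / 2) * ?w r powr (- (?n / 2) - of_nat 1) * (- 2 * r) =
        ?w r powr (- (?n / 2)) * (?n * r / ?w r)"
      by metis
  qed
  have de: "((\<lambda>r. exp (- q (a - r *\<^sub>R x) / (2 * ?w r))) has_real_derivative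
      exp (- q (a - r *\<^sub>R x) / (2 * ?w r)) *
        ((x \<bullet> (Q *v (a - r *\<^sub>R x))) / ?w r - r * q (a - r *\<^sub>R x) / (?w r)\<^sup>2)) (at r)"
  proof (rule DERIV_cong[OF DERIV_fun_exp[OF DERIV_divide[OF DERIV_minus[OF dq] DERIV_cmult[OF dw]]]])
    have aux: "E * ((- (- 2 * X) * (2 * W) - - Z * (2 * (- 2 * r))) / (2 * W * (2 * W))) =
        E * (X / W - r * Z / W\<^sup>2)" if "W \<noteq> 0" for E X Z W :: real
      using that by (simp add: field_simps power2_eq_square)
    show "exp (- q (a - r *\<^sub>R x) / (2 * ?w r)) *
        ((- (- 2 * (x \<bullet> (Q *v (a - r *\<^sub>R x)))) * (2 * ?w r) -
          - q (a - r *\<^sub>R x) * (2 * (- 2 * r))) / (2 * ?w r * (2 * ?w r))) =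
      exp (- q (a - r *\<^sub>R x) / (2 * ?w r)) *
        ((x \<bullet> (Q *v (a - r *\<^sub>R x))) / ?w r - r * q (a - r *\<^sub>R x) / (?w r)\<^sup>2)"
      by (rule aux) (use w in simp)
  qed (use w in simp)
  show ?thesis
    unfolding mehler_def bump_def mehler'_def
    by (rule DERIV_cong[OF DERIV_mult[OF dp de]]) (simp add: algebra_simps)
qed

section \<open>Bounds along the flow, uniform in the starting point\<close>

lemma mehler_bounds:
  assumes "v > 0" "0 \<le> r" "r \<le> 1"
  shows "0 \<le> mehler v a r x" "mehler v a r x \<le> v powr (- (real CARD('m) / 2))"
proof -
  let ?w = "v + 1 - r\<^sup>2"
  have w: "v \<le> ?w" "?w > 0" using width_pos[of v r] assms by auto
  show "0 \<le> mehler v a r x"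
    by (simp add: mehler_def bump_def)
  have "mehler v a r x \<le> ?w powr (- (real CARD('m) / 2)) * 1"
    unfolding mehler_def bump_def using w q_nonneg by (intro mult_left_mono) auto
  also have "\<dots> \<le> v powr (- (real CARD('m) / 2))"
    using w assms by (simp add: powr_mono2')
  finally show "mehler v a r x \<le> v powr (- (real CARD('m) / 2))" .
qed

text \<open>Boundedness in \<open>x\<close> makes both terms of the generator integrable under every
  probability law, and uniformity in \<open>r\<close> prepares the use of Fubini. The lower limit
  \<open>\<epsilon>\<close> absorbs the factor \<open>1 / r\<close> from
  \<open>exp_q_bounds\<close>.\<close>

lemma drift_diffusion_mehler_bounded:
  assumes "v > 0" "0 < \<epsilon>"
  obtains K where "\<And>r x. \<epsilon> \<le> r \<Longrightarrow> r \<le> 1 \<Longrightarrow> \<bar>drift (mehler v a r) x\<bar> \<le> K"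
    "\<And>r x. \<epsilon> \<le> r \<Longrightarrow> r \<le> 1 \<Longrightarrow> \<bar>diffusion S (mehler v a r) x\<bar> \<le> K"
proof
  fix r x assume r: "\<epsilon> \<le> r" "r \<le> 1"
  let ?w = "v + 1 - r\<^sup>2" and ?n = "real CARD('m)"
  let ?y = "a - r *\<^sub>R x"
  let ?E = "exp (- q ?y / (2 * ?w))" and ?V = "v powr (- (real CARD('m) / 2))" and ?W = "?w powr (- (real CARD('m) / 2))"
  define K1 where "K1 = (norm (D *v a) * (1 + 2 * (v + 1)) + 2 * (v + 1)) / \<epsilon>"
  define K2 where "K2 = (2 * (v + 1)) / v\<^sup>2 + ?n / v"
  have r': "r > 0" "r\<^sup>2 \<le> 1" "r \<ge> 0" using assms r by (auto simp: power_le_one)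
  have w: "v \<le> ?w" "?w > 0" "?w \<le> v + 1" using assms r' by auto
  have W: "0 \<le> ?W" "?W \<le> ?V" using w assms by (auto simp: powr_mono2')
  have rw: "r / ?w \<le> 1 / v" "0 \<le> r / ?w" using w assms r r' by (auto intro!: frac_le)
  have K1: "K1 \<ge> 0" using assms by (simp add: K1_def)
  have K2: "K2 \<ge> 0" using assms by (simp add: K2_def)
  note b = exp_q_bounds[OF w(2) r'(1)]
  have "\<bar>x \<bullet> (Q *v ?y)\<bar> * ?E \<le> (norm (D *v a) * (1 + 2 * ?w) + 2 * ?w) / r"
    by (rule b)
  also have "\<dots> \<le> K1"
    unfolding K1_def using w r assms by (intro frac_le add_mono mult_left_mono) auto
  finally have 1: "\<bar>x \<bullet> (Q *v ?y)\<bar> * ?E \<le> K1" .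
  have "\<bar>drift (mehler v a r) x\<bar> = ?W * ((r / ?w) * (\<bar>x \<bullet> (Q *v ?y)\<bar> * ?E))"
    unfolding mehler_def drift_bump bump_def using r' W by (simp add: abs_mult abs_of_pos[OF w(2)] mult_ac)
  also have "\<dots> \<le> ?V * ((1 / v) * K1)"
    using W rw 1 K1 assms by (intro mult_mono mult_nonneg_nonneg) auto
  also have "\<dots> \<le> max (?V * ((1 / v) * K1)) (?V * K2)" by simp
  finally show "\<bar>drift (mehler v a r) x\<bar> \<le> max (?V * ((1 / v) * K1)) (?V * K2)" .
  have "\<bar>(r / ?w)\<^sup>2 * q ?y - r\<^sup>2 / ?w * ?n\<bar> * ?E \<le> ((r / ?w)\<^sup>2 * q ?y + r\<^sup>2 / ?w * ?n) * ?E"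
    using q_nonneg[of ?y] w by (intro mult_right_mono) (auto simp: abs_le_iff)
  also have "\<dots> = (r / ?w)\<^sup>2 * (q ?y * ?E) + r\<^sup>2 / ?w * ?n * ?E"
    by (simp add: algebra_simps)
  also have "\<dots> \<le> (1 / v)\<^sup>2 * (2 * (v + 1)) + 1 / v * ?n * 1"
  proof (rule add_mono)
    have 3: "q ?y * ?E \<le> 2 * (v + 1)"
      by (rule order_trans[OF b(2)]) (use w in simp)
    have 4: "(r / ?w)\<^sup>2 \<le> (1 / v)\<^sup>2"
      using rw by (intro power_mono) auto
    show "(r / ?w)\<^sup>2 * (q ?y * ?E) \<le> (1 / v)\<^sup>2 * (2 * (v + 1))"
      by (rule mult_mono[OF 4 3]) (use q_nonneg[of ?y] in auto)
    have 5: "r\<^sup>2 / ?w \<le> 1 / v"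
      using r' w assms by (intro frac_le) auto
    show "r\<^sup>2 / ?w * ?n * ?E \<le> 1 / v * ?n * 1"
      by (intro mult_mono 5 b(1) order_refl) (use assms in auto)
  qed
  also have "\<dots> = K2"
    by (simp add: K2_def power_divide)
  finally have 2: "\<bar>(r / ?w)\<^sup>2 * q ?y - r\<^sup>2 / ?w * ?n\<bar> * ?E \<le> K2" .
  have "\<bar>diffusion S (mehler v a r) x\<bar> = ?W * (\<bar>(r / ?w)\<^sup>2 * q ?y - r\<^sup>2 / ?w * ?n\<bar> * ?E)"
    unfolding mehler_def diffusion_bump bump_def using W by (simp add: abs_mult mult_ac)
  also have "\<dots> \<le> ?V * K2"
    using W 2 K2 by (intro mult_mono mult_nonneg_nonneg) auto
  also have "\<dots> \<le> max (?V * ((1 / v) * K1)) (?V * K2)" by simp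
  finally show "\<bar>diffusion S (mehler v a r) x\<bar> \<le> max (?V * ((1 / v) * K1)) (?V * K2)" .
qed

end

subsection \<open>Uniqueness of the law\<close>

context gaussian_factor
begin

lemma measurable_linear [measurable]: "(*v) (A :: real^'m^'m) \<in> borel_measurable borel"
  by (intro borel_measurable_continuous_onI linear_continuous_on matrix_vector_mul_bounded_linear)

lemma measurable_q [measurable]: "q \<in> borel_measurable borel"
  by (intro borel_measurable_continuous_onI continuous_intros)

text \<open>The analytic side of the equivalence for a random vector, with membership in the test
  class unfolded.\<close>

definition stein_law :: "'a measure \<Rightarrow> ('a \<Rightarrow> real^'m) \<Rightarrow> bool" where
  "stein_law M Y \<longleftrightarrow> (\<forall>f. C2_vec f \<longrightarrow> integrable M (\<lambda>\<omega>. drift f (Y \<omega>)) \<longrightarrow>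
    integrable M (\<lambda>\<omega>. diffusion S f (Y \<omega>)) \<longrightarrow>
    (\<integral>\<omega>. - drift f (Y \<omega>) + diffusion S f (Y \<omega>) \<partial>M) = 0)"

text \<open>The Stein identity and \<open>mehler_backward\<close> make the expected
  \<open>r\<close>-derivative vanish at every \<open>r\<close> in the interval; integrating over
  \<open>r\<close> gives equality at the endpoints.\<close>

lemma stein_law_mehler_constant:
  assumes M: "prob_space M" and Y [measurable]: "Y \<in> borel_measurable M" and stein: "stein_law M Y"
    and v: "v > 0" and \<epsilon>: "0 < \<epsilon>" "\<epsilon> \<le> 1"
  shows "(\<integral>\<omega>. mehler v a \<epsilon> (Y \<omega>) \<partial>M) = (\<integral>\<omega>. mehler v a 1 (Y \<omega>) \<partial>M)"
proof -
  interpret prob_space M by fact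
  interpret pair_sigma_finite M "lborel :: real measure" ..
  obtain K where K: "\<And>r x. \<epsilon> \<le> r \<Longrightarrow> r \<le> 1 \<Longrightarrow> \<bar>drift (mehler v a r) x\<bar> \<le> K"
    "\<And>r x. \<epsilon> \<le> r \<Longrightarrow> r \<le> 1 \<Longrightarrow> \<bar>diffusion S (mehler v a r) x\<bar> \<le> K"
    using drift_diffusion_mehler_bounded[OF v \<epsilon>(1)] by blast
  have C2: "C2_vec (mehler v a r)" for r
    unfolding mehler_def by (rule C2_vec_bump)
  have [measurable]: "drift (mehler v a r) \<in> borel_measurable borel"
      "diffusion S (mehler v a r) \<in> borel_measurable borel" "mehler v a r \<in> borel_measurable borel" for r
    by (auto intro!: borel_measurable_continuous_onI continuous_on_drift continuous_on_diffusion C2)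
      (auto simp: mehler_def intro!: continuous_intros)
  have int0: "(\<integral>\<omega>. mehler' v a r (Y \<omega>) \<partial>M) = 0" if r: "\<epsilon> \<le> r" "r \<le> 1" for r
  proof -
    have "integrable M (\<lambda>\<omega>. drift (mehler v a r) (Y \<omega>))" "integrable M (\<lambda>\<omega>. diffusion S (mehler v a r) (Y \<omega>))"
      by (rule integrable_const_bound[where B = K]; use K r in simp)+
    with stein C2 have "(\<integral>\<omega>. - drift (mehler v a r) (Y \<omega>) + diffusion S (mehler v a r) (Y \<omega>) \<partial>M) = 0"
      by (simp add: stein_law_def)
    also have "(\<lambda>\<omega>. - drift (mehler v a r) (Y \<omega>) + diffusion S (mehler v a r) (Y \<omega>)) =
        (\<lambda>\<omega>. - r * mehler' v a r (Y \<omega>))"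
      using mehler_backward[of r v a] by (simp add: fun_eq_iff)
    finally show ?thesis
      using r \<epsilon> by simp
  qed
  \<comment> \<open>Instead of differentiating under the expectation, the derivative is integrated
    over the product space: one order of integration gives 0, the other the expected
    increment.\<close>
  define H where "H = (\<lambda>(\<omega>, r). mehler' v a r (Y \<omega>) * indicator {\<epsilon>..1} r)"
  have H_meas: "H \<in> borel_measurable (M \<Otimes>\<^sub>M lborel)"
    unfolding H_def mehler'_def mehler_def bump_def case_prod_beta by measurable
  have "integrable (M \<Otimes>\<^sub>M lborel) H"
  \<comment> \<open>The bound \<open>2 * K / \<epsilon>\<close> is the bound \<open>2 * K\<close> on
    drift minus diffusion, divided by \<open>r \<ge> \<epsilon>\<close>.\<close>
  proof (rule integrableI_bounded_set[where A = "space M \<times> {\<epsilon>..1}" and B = "2 * K / \<epsilon>"])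
    show "emeasure (M \<Otimes>\<^sub>M lborel) (space M \<times> {\<epsilon>..1}) < \<infinity>"
      using \<epsilon> by (subst lborel.emeasure_pair_measure_Times) (auto simp: emeasure_space_1)
    show "AE x in M \<Otimes>\<^sub>M lborel. x \<in> space M \<times> {\<epsilon>..1} \<longrightarrow> norm (H x) \<le> 2 * K / \<epsilon>"
    proof (rule AE_I2, clarify)
      fix \<omega> r assume r: "r \<in> {\<epsilon>..1}"
      have "\<epsilon> * \<bar>mehler' v a r (Y \<omega>)\<bar> \<le> \<bar>r * mehler' v a r (Y \<omega>)\<bar>"
        using r \<epsilon> by (simp add: abs_mult mult_right_mono)
      also have "\<dots> \<le> 2 * K"
        unfolding mehler_backward using K[of r "Y \<omega>"] r by auto
      finally show "norm (H (\<omega>, r)) \<le> 2 * K / \<epsilon>"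
        using r \<epsilon> by (simp add: H_def field_simps)
    qed
    show "AE x in M \<Otimes>\<^sub>M lborel. x \<notin> space M \<times> {\<epsilon>..1} \<longrightarrow> H x = 0"
      by (rule AE_I2) (auto simp: H_def space_pair_measure split: split_indicator_asm)
  qed (simp_all add: H_meas)
  then have "(\<integral>r. \<integral>\<omega>. H (\<omega>, r) \<partial>M \<partial>lborel) = (\<integral>\<omega>. \<integral>r. H (\<omega>, r) \<partial>lborel \<partial>M)"
    using Fubini_integral[of "\<lambda>\<omega> r. H (\<omega>, r)"] by simp
  moreover have "(\<integral>\<omega>. H (\<omega>, r) \<partial>M) = 0" for r
    using int0[of r] by (cases "r \<in> {\<epsilon>..1}") (auto simp: H_def)
  moreover have "(\<integral>r. H (\<omega>, r) \<partial>lborel) = mehler v a 1 (Y \<omega>) - mehler v a \<epsilon> (Y \<omega>)" for \<omega>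
    unfolding H_def prod.case
  proof (rule integral_FTC_Icc_real[OF \<epsilon>(2)])
    fix r assume r: "\<epsilon> \<le> r" "r \<le> 1"
    then have w: "v + 1 - r\<^sup>2 > 0"
      using width_pos[of v r] v \<epsilon> by simp
    show "((\<lambda>r. mehler v a r (Y \<omega>)) has_real_derivative mehler' v a r (Y \<omega>)) (at r)"
      using v r \<epsilon> by (intro DERIV_mehler) auto
    then have "isCont (\<lambda>r. mehler v a r (Y \<omega>)) r"
      by (rule DERIV_isCont)
    moreover have "isCont (\<lambda>r. q (a - r *\<^sub>R Y \<omega>)) r" "isCont (\<lambda>r. Q *v (a - r *\<^sub>R Y \<omega>)) r"
      unfolding q_def
      by (intro continuous_intros bounded_linear.isCont[OF matrix_vector_mul_bounded_linear])+
    ultimately show "isCont (\<lambda>r. mehler' v a r (Y \<omega>)) r"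
      unfolding mehler'_def using w by (intro continuous_intros) auto
  qed
  ultimately have "0 = (\<integral>\<omega>. mehler v a 1 (Y \<omega>) - mehler v a \<epsilon> (Y \<omega>) \<partial>M)"
    by simp
  also have "\<dots> = (\<integral>\<omega>. mehler v a 1 (Y \<omega>) \<partial>M) - (\<integral>\<omega>. mehler v a \<epsilon> (Y \<omega>) \<partial>M)"
  proof (rule Bochner_Integration.integral_diff)
    show "integrable M (\<lambda>\<omega>. mehler v a 1 (Y \<omega>))" "integrable M (\<lambda>\<omega>. mehler v a \<epsilon> (Y \<omega>))"
      using mehler_bounds[OF v, of _ a] \<epsilon>
      by (auto intro!: integrable_const_bound[where B = "v powr (- (real CARD('m) / 2))"] simp: abs_of_nonneg)
  qed
  finally show ?thesis by simp
qed

text \<open>As \<open>r\<close> tends to 0, \<open>mehler v a r\<close> tends to a function constant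
  in its argument, so the common expectation depends on \<open>v\<close> and \<open>a\<close> but
  not on the law of \<open>Y\<close>.\<close>

lemma stein_law_mehler:
  assumes M: "prob_space M" and Y [measurable]: "Y \<in> borel_measurable M" and stein: "stein_law M Y"
    and v: "v > 0"
  shows "(\<integral>\<omega>. mehler v a 1 (Y \<omega>) \<partial>M) = mehler v a 0 0"
proof -
  interpret prob_space M by fact
  define r where "r n = 1 / real (Suc n)" for n
  have r: "0 < r n" "r n \<le> 1" for n
    by (auto simp: r_def)
  have r_lim: "r \<longlonglongrightarrow> 0"
    unfolding r_def using LIMSEQ_Suc[OF lim_1_over_n] by simp
  have [measurable]: "mehler v a s \<in> borel_measurable borel" for s
    by (auto simp: mehler_def intro!: borel_measurable_continuous_onI continuous_intros)
  have "(\<lambda>n. \<integral>\<omega>. mehler v a (r n) (Y \<omega>) \<partial>M) \<longlonglongrightarrow> (\<integral>\<omega>. mehler v a 0 (Y \<omega>) \<partial>M)"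
  proof (rule integral_dominated_convergence[where w = "\<lambda>_. v powr (- (real CARD('m) / 2))"])
    show "AE \<omega> in M. (\<lambda>n. mehler v a (r n) (Y \<omega>)) \<longlonglongrightarrow> mehler v a 0 (Y \<omega>)"
    proof (rule AE_I2)
      fix \<omega>
      have "isCont (\<lambda>r. mehler v a r (Y \<omega>)) 0"
        using DERIV_mehler[OF v, of 0 a "Y \<omega>"] by (auto intro: DERIV_isCont)
      then show "(\<lambda>n. mehler v a (r n) (Y \<omega>)) \<longlonglongrightarrow> mehler v a 0 (Y \<omega>)"
        using r_lim by (rule isCont_tendsto_compose)
    qed
    show "AE \<omega> in M. norm (mehler v a (r n) (Y \<omega>)) \<le> v powr (- (real CARD('m) / 2))" for n
      using mehler_bounds[OF v, of "r n" a] r[of n] by (auto simp: abs_of_nonneg)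
  qed auto
  moreover have "(\<integral>\<omega>. mehler v a (r n) (Y \<omega>) \<partial>M) = (\<integral>\<omega>. mehler v a 1 (Y \<omega>) \<partial>M)" for n
    by (rule stein_law_mehler_constant[OF M Y stein v r])
  ultimately have "(\<integral>\<omega>. mehler v a 1 (Y \<omega>) \<partial>M) = (\<integral>\<omega>. mehler v a 0 (Y \<omega>) \<partial>M)"
    by (simp add: LIMSEQ_const_iff)
  also have "(\<lambda>\<omega>. mehler v a 0 (Y \<omega>)) = (\<lambda>\<omega>. mehler v a 0 0)"
    by (simp add: mehler_def bump_def)
  finally show ?thesis
    by (simp add: prob_space)
qed

section \<open>Gaussian smoothing determines a probability measure\<close>

lemma nn_integral_gaussian_shift:
  assumes [measurable]: "h \<in> borel_measurable borel" and s: "s > 0"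
  shows "(\<integral>\<^sup>+z. h (x + s *\<^sub>R z) * ennreal (exp (- q z / 2)) \<partial>lborel) * ennreal (s ^ CARD('m)) =
    (\<integral>\<^sup>+a. h a * ennreal (exp (- q (a - x) / (2 * s\<^sup>2))) \<partial>lborel)"
proof -
  \<comment> \<open>The substitution \<open>a = x + s *\<^sub>R z\<close> has Jacobian
    \<open>s ^ CARD('m)\<close>; it turns averaging around \<open>x\<close> into integration over
    the centres \<open>a\<close> of bumps.\<close>
  have "(\<integral>\<^sup>+a. h a * ennreal (exp (- q (a - x) / (2 * s\<^sup>2))) \<partial>lborel) =
    (\<integral>\<^sup>+a. h a * ennreal (exp (- q (a - x) / (2 * s\<^sup>2)))
       \<partial>density (distr lborel borel (\<lambda>z. x + s *\<^sub>R z)) (\<lambda>_. \<bar>s\<bar> ^ DIM(real^'m)))"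
    using lborel_affine[of s x] s by simp
  also have "\<dots> = (\<integral>\<^sup>+z. ennreal (s ^ CARD('m)) * (h (x + s *\<^sub>R z) * ennreal (exp (- q (s *\<^sub>R z) / (2 * s\<^sup>2)))) \<partial>lborel)"
    using s by (simp add: nn_integral_density nn_integral_distr)
  also have "\<dots> = (\<integral>\<^sup>+z. ennreal (s ^ CARD('m)) * (h (x + s *\<^sub>R z) * ennreal (exp (- q z / 2))) \<partial>lborel)"
    using s by (simp add: q_scaleR)
  finally show ?thesis
    by (simp add: nn_integral_cmult mult.commute)
qed

text \<open>Agreement on bumps passes to Gaussian smoothings of any nonnegative function, then with
  vanishing scale to continuous functions with values in \<open>[0, 1]\<close>, then to open sets,
  which are stable under intersection and generate the Borel sets.\<close>

lemma measure_eqI_gaussian_smoothing: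
  fixes M N :: "(real^'m) measure"
  assumes M: "prob_space M" "sets M = sets borel" and N: "prob_space N" "sets N = sets borel"
    and eq: "\<And>a v. v > 0 \<Longrightarrow> (\<integral>x. exp (- q (a - x) / (2 * v)) \<partial>M) = (\<integral>x. exp (- q (a - x) / (2 * v)) \<partial>N)"
  shows "M = N"
proof -
  let ?k = "\<lambda>z. ennreal (exp (- q z / 2))"
  define Z where "Z = (\<integral>\<^sup>+z. ?k z \<partial>lborel)"
  have Z: "Z \<noteq> 0" "Z < \<infinity>"
    unfolding Z_def nn_integral_exp_q using det_C by (auto simp: det_S)
  have cancel: "x = y" if "c \<noteq> 0" "c \<noteq> \<infinity>" "x * c = y * c" for x y c :: ennreal
    using that ennreal_mult_cancel_left[of c x y] by (auto simp: mult.commute)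
  have nn_eq: "(\<integral>\<^sup>+x. ennreal (exp (- q (a - x) / (2 * v))) \<partial>M) = (\<integral>\<^sup>+x. ennreal (exp (- q (a - x) / (2 * v))) \<partial>N)"
    if v: "v > 0" for a v
  proof -
    have "(\<integral>\<^sup>+x. ennreal (exp (- q (a - x) / (2 * v))) \<partial>P) = ennreal (\<integral>x. exp (- q (a - x) / (2 * v)) \<partial>P)"
      if P: "prob_space P" "sets P = sets borel" for P
    proof (rule nn_integral_eq_integral)
      interpret prob_space P by fact
      note [measurable_cong] = P(2)
      show "integrable P (\<lambda>x. exp (- q (a - x) / (2 * v)))"
      proof (rule integrable_const_bound[where B = 1])
        have "norm (exp (- q (a - x) / (2 * v))) \<le> 1" for x
          using v q_nonneg[of "a - x"] by simp
        then show "AE x in P. norm (exp (- q (a - x) / (2 * v))) \<le> 1"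
          by (intro AE_I2)
      qed measurable
    qed simp
    then show ?thesis
      using M N eq[OF v, of a] by metis
  qed
  \<comment> \<open>Tonelli expresses the smoothed integral as a mixture over \<open>a\<close> of
    integrals of bumps with \<open>v = s\<^sup>2\<close>, where the two measures agree.\<close>
  have smooth_eq: "(\<integral>\<^sup>+x. (\<integral>\<^sup>+z. h (x + s *\<^sub>R z) * ?k z \<partial>lborel) \<partial>M) = (\<integral>\<^sup>+x. (\<integral>\<^sup>+z. h (x + s *\<^sub>R z) * ?k z \<partial>lborel) \<partial>N)"
    if h [measurable]: "h \<in> borel_measurable borel" and s: "s > 0" for h :: "real^'m \<Rightarrow> ennreal" and s
  proof -
    have *: "(\<integral>\<^sup>+x. (\<integral>\<^sup>+z. h (x + s *\<^sub>R z) * ?k z \<partial>lborel) \<partial>P) * ennreal (s ^ CARD('m)) =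
      (\<integral>\<^sup>+a. h a * (\<integral>\<^sup>+x. ennreal (exp (- q (a - x) / (2 * s\<^sup>2))) \<partial>P) \<partial>lborel)"
      if P: "prob_space P" "sets P = sets borel" for P
    proof -
      interpret prob_space P by fact
      interpret pair_sigma_finite P "lborel :: (real^'m) measure" ..
      note [measurable_cong] = P(2)
      have "(\<integral>\<^sup>+x. (\<integral>\<^sup>+z. h (x + s *\<^sub>R z) * ?k z \<partial>lborel) \<partial>P) * ennreal (s ^ CARD('m)) =
          (\<integral>\<^sup>+x. (\<integral>\<^sup>+z. h (x + s *\<^sub>R z) * ?k z \<partial>lborel) * ennreal (s ^ CARD('m)) \<partial>P)"
        by (rule nn_integral_multc[symmetric]) measurable
      also have "\<dots> = (\<integral>\<^sup>+x. (\<integral>\<^sup>+a. h a * ennreal (exp (- q (a - x) / (2 * s\<^sup>2))) \<partial>lborel) \<partial>P)"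
        by (simp only: nn_integral_gaussian_shift[OF h s])
      also have "\<dots> = (\<integral>\<^sup>+a. (\<integral>\<^sup>+x. h a * ennreal (exp (- q (a - x) / (2 * s\<^sup>2))) \<partial>P) \<partial>lborel)"
        by (rule Fubini'[symmetric]) measurable
      also have "\<dots> = (\<integral>\<^sup>+a. h a * (\<integral>\<^sup>+x. ennreal (exp (- q (a - x) / (2 * s\<^sup>2))) \<partial>P) \<partial>lborel)"
        by (intro nn_integral_cong nn_integral_cmult) measurable
      finally show ?thesis .
    qed
    have s2: "s\<^sup>2 > 0" using s by simp
    have c: "ennreal (s ^ CARD('m)) \<noteq> 0" "ennreal (s ^ CARD('m)) \<noteq> \<infinity>"
      using s by auto
    show ?thesis
      by (rule cancel[OF c]) (simp only: *[OF M] *[OF N] nn_eq[OF s2])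
  qed
  have cont_eq: "(\<integral>\<^sup>+x. ennreal (h x) \<partial>M) = (\<integral>\<^sup>+x. ennreal (h x) \<partial>N)"
    if h: "continuous_on UNIV h" "\<And>x. 0 \<le> h x" "\<And>x. h x \<le> 1" for h :: "real^'m \<Rightarrow> real"
  proof -
    \<comment> \<open>Smoothing at scale \<open>1 / (n + 1)\<close>. The kernel is not normalized,
      so the limit is \<open>h x\<close> times the mass \<open>Z\<close>, which is cancelled
      afterwards.\<close>
    define J where "J n x = (\<integral>\<^sup>+z. ennreal (h (x + (1 / real (Suc n)) *\<^sub>R z)) * ?k z \<partial>lborel)" for n x
    have [measurable]: "h \<in> borel_measurable borel"
      using h by (intro borel_measurable_continuous_onI)
    have J_lim: "(\<lambda>n. J n x) \<longlonglongrightarrow> ennreal (h x) * Z" for x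
    proof -
      have "(\<lambda>n. J n x) \<longlonglongrightarrow> (\<integral>\<^sup>+z. ennreal (h x) * ?k z \<partial>lborel)"
        unfolding J_def
      proof (rule nn_integral_dominated_convergence[where w = ?k])
        show "AE z in lborel. ennreal (h (x + (1 / real (Suc n)) *\<^sub>R z)) * ?k z \<le> ?k z" for n
          using h by (intro AE_I2) (simp add: ennreal_mult[symmetric] mult_left_le_one_le)
        show "AE z in lborel. (\<lambda>n. ennreal (h (x + (1 / real (Suc n)) *\<^sub>R z)) * ?k z) \<longlonglongrightarrow> ennreal (h x) * ?k z"
        proof (rule AE_I2)
          fix z
          have "(\<lambda>n. 1 / real (Suc n)) \<longlonglongrightarrow> 0"
            using LIMSEQ_Suc[OF lim_1_over_n] by simp
          then have "(\<lambda>n. x + (1 / real (Suc n)) *\<^sub>R z) \<longlonglongrightarrow> x + 0 *\<^sub>R z"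
            by (intro tendsto_intros)
          then have "(\<lambda>n. h (x + (1 / real (Suc n)) *\<^sub>R z)) \<longlonglongrightarrow> h x"
            using h(1) by (auto intro: continuous_on_tendsto_compose)
          then have "(\<lambda>n. ennreal (h (x + (1 / real (Suc n)) *\<^sub>R z) * exp (- q z / 2))) \<longlonglongrightarrow> ennreal (h x * exp (- q z / 2))"
            by (intro tendsto_intros)
          then show "(\<lambda>n. ennreal (h (x + (1 / real (Suc n)) *\<^sub>R z)) * ?k z) \<longlonglongrightarrow> ennreal (h x) * ?k z"
            using h by (simp add: ennreal_mult)
        qed
        show "(\<integral>\<^sup>+z. ?k z \<partial>lborel) < \<infinity>"
          using Z by (simp add: Z_def)
      qed measurable
      then show ?thesis
        by (simp add: nn_integral_cmult Z_def)
    qed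
    have J_le: "J n x \<le> Z" for n x
      unfolding J_def Z_def using h
      by (intro nn_integral_mono) (simp add: ennreal_mult[symmetric] mult_left_le_one_le)
    have lim: "(\<lambda>n. \<integral>\<^sup>+x. J n x \<partial>P) \<longlonglongrightarrow> (\<integral>\<^sup>+x. ennreal (h x) * Z \<partial>P)"
      if P: "prob_space P" "sets P = sets borel" for P
    proof -
      interpret prob_space P by fact
      note [measurable_cong] = P(2)
      show ?thesis
      proof (rule nn_integral_dominated_convergence[where w = "\<lambda>_. Z"])
        show "J n \<in> borel_measurable P" for n
          unfolding J_def by measurable
        show "(\<integral>\<^sup>+x. Z \<partial>P) < \<infinity>"
          using Z by (simp add: emeasure_space_1)
      qed (use J_le J_lim in auto)
    qed
    have "(\<integral>\<^sup>+x. J n x \<partial>M) = (\<integral>\<^sup>+x. J n x \<partial>N)" for n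
      unfolding J_def by (rule smooth_eq) auto
    with lim[OF M] have "(\<lambda>n. \<integral>\<^sup>+x. J n x \<partial>N) \<longlonglongrightarrow> (\<integral>\<^sup>+x. ennreal (h x) * Z \<partial>M)"
      by simp
    then have e1: "(\<integral>\<^sup>+x. ennreal (h x) * Z \<partial>M) = (\<integral>\<^sup>+x. ennreal (h x) * Z \<partial>N)"
      using lim[OF N] by (rule LIMSEQ_unique)
    have e2: "(\<integral>\<^sup>+x. ennreal (h x) * Z \<partial>P) = (\<integral>\<^sup>+x. ennreal (h x) \<partial>P) * Z" if P: "sets P = sets borel" for P
    proof (rule nn_integral_multc)
      show "(\<lambda>x. ennreal (h x)) \<in> borel_measurable P"
        unfolding measurable_cong_sets[OF P refl] by measurable
    qed
    have "(\<integral>\<^sup>+x. ennreal (h x) \<partial>M) * Z = (\<integral>\<^sup>+x. ennreal (h x) \<partial>N) * Z"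
      unfolding e2[OF M(2), symmetric] e2[OF N(2), symmetric] by (rule e1)
    then show ?thesis
      by (rule cancel[rotated 2]) (use Z in auto)
  qed
  have open_eq: "emeasure M U = emeasure N U" if U: "open U" for U
  \<comment> \<open>The whole space is separated because \<open>infdist\<close> to the empty set is
    0 by convention, so the approximating functions below would vanish identically.\<close>
  proof (cases "U = UNIV")
    case True
    then show ?thesis
      using prob_space.emeasure_space_1[OF M(1)] prob_space.emeasure_space_1[OF N(1)]
        sets_eq_imp_space_eq[OF M(2)] sets_eq_imp_space_eq[OF N(2)] by simp
  next
    case False
    define h where "h n x = min 1 (real n * infdist x (- U))" for n x
    have h: "continuous_on UNIV (h n)" "0 \<le> h n x" "h n x \<le> 1" for n x
      unfolding h_def by (auto intro!: continuous_intros infdist_nonneg mult_nonneg_nonneg)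
    have h_lim: "(\<lambda>n. ennreal (h n x)) \<longlonglongrightarrow> indicator U x" for x
    proof (cases "x \<in> U")
      case True
      have "infdist x (- U) > 0"
        using True False U by (subst infdist_pos_not_in_closed) auto
      then obtain n0 where "1 \<le> real n0 * infdist x (- U)"
        by (metis less_imp_le reals_Archimedean3)
      then have "h n x = 1" if "n \<ge> n0" for n
        using that mult_right_mono[of "real n0" "real n" "infdist x (- U)"]
        by (auto simp: h_def infdist_nonneg)
      then have "eventually (\<lambda>n. ennreal (h n x) = indicator U x) sequentially"
        using True by (auto simp: eventually_sequentially)
      then show ?thesis by (rule tendsto_eventually)
    next
      case False
      then show ?thesis by (simp add: h_def)
    qed
    have lim: "(\<lambda>n. \<integral>\<^sup>+x. ennreal (h n x) \<partial>P) \<longlonglongrightarrow> emeasure P U"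
      if P: "prob_space P" "sets P = sets borel" for P
    proof -
      interpret prob_space P by fact
      have "(\<lambda>n. \<integral>\<^sup>+x. ennreal (h n x) \<partial>P) \<longlonglongrightarrow> (\<integral>\<^sup>+x. indicator U x \<partial>P)"
      proof (rule nn_integral_dominated_convergence[where w = "\<lambda>_. 1"])
        show "(\<lambda>x. ennreal (h n x)) \<in> borel_measurable P" for n
          unfolding measurable_cong_sets[OF P(2) refl]
          by (intro measurable_compose[OF _ measurable_ennreal] borel_measurable_continuous_onI h)
        show "indicator U \<in> borel_measurable P"
          using U P by (intro borel_measurable_indicator) simp
      qed (use h h_lim in \<open>auto simp: emeasure_space_1\<close>)
      then show ?thesis
        using U P by simp
    qed
    have "(\<integral>\<^sup>+x. ennreal (h n x) \<partial>M) = (\<integral>\<^sup>+x. ennreal (h n x) \<partial>N)" for n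
      by (rule cont_eq[OF h])
    with lim[OF M] have "(\<lambda>n. \<integral>\<^sup>+x. ennreal (h n x) \<partial>N) \<longlonglongrightarrow> emeasure M U"
      by simp
    then show ?thesis
      using lim[OF N] by (rule LIMSEQ_unique)
  qed
  show ?thesis
  proof (rule measure_eqI_generator_eq[where E = "{U. open U}" and \<Omega> = UNIV and A = "\<lambda>_. UNIV"])
    show "Int_stable {U :: (real^'m) set. open U}"
      by (auto simp: Int_stable_def)
    show "sets M = sigma_sets UNIV {U. open U}" "sets N = sigma_sets UNIV {U. open U}"
      unfolding M(2) N(2) by (simp_all add: borel_def)
    show "emeasure M U = emeasure N U" if "U \<in> {U. open U}" for U
      using that open_eq by blast
    show "emeasure M UNIV \<noteq> \<infinity>" for i :: nat
      using prob_space.emeasure_space_1[OF M(1)] sets_eq_imp_space_eq[OF M(2)] by simp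
  qed auto
qed

theorem stein_characterization:
  assumes M: "prob_space M" and Y [measurable]: "Y \<in> borel_measurable M"
  shows "distributed M lborel Y (\<lambda>x. ennreal (mvn_density 0 S x)) \<longleftrightarrow> stein_law M Y"
proof
  assume "distributed M lborel Y (\<lambda>x. ennreal (mvn_density 0 S x))"
  then show "stein_law M Y"
    unfolding stein_law_def using stein_identity_of_density by blast
next
  assume stein: "stein_law M Y"
  have [measurable]: "(\<lambda>x. ennreal (mvn_density 0 S x)) \<in> borel_measurable borel"
    unfolding mvn_density_0 by measurable
  \<comment> \<open>The normal law satisfies the Stein identity by the direction already proved, so
    \<open>stein_law_mehler\<close> gives bumps the same expectation \<open>mehler v a 0 0\<close>
    under \<open>G\<close> and under the law of \<open>Y\<close>; this takes the place of computing
    a Gaussian convolution.\<close>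
  define G where "G = density lborel (\<lambda>x. ennreal (mvn_density 0 S x))"
  have G: "prob_space G" "sets G = sets borel"
    by (auto intro!: prob_spaceI simp: G_def emeasure_density nn_integral_mvn_density)
  have "distributed G lborel (\<lambda>x. x) (\<lambda>x. ennreal (mvn_density 0 S x))"
    unfolding distributed_def by (auto simp: G_def distr_id2)
  then have "stein_law G (\<lambda>x. x)"
    unfolding stein_law_def using stein_identity_of_density by blast
  have mehler_1: "mehler v a 1 x = v powr (- (real CARD('m) / 2)) * exp (- q (a - x) / (2 * v))" for v a x
    by (simp add: mehler_def bump_def)
  interpret M: prob_space M by fact
  have "distr M borel Y = G"
  proof (rule measure_eqI_gaussian_smoothing)
    show "prob_space (distr M borel Y)"
      by (rule M.prob_space_distr) simp
    show "(\<integral>x. exp (- q (a - x) / (2 * v)) \<partial>distr M borel Y) = (\<integral>x. exp (- q (a - x) / (2 * v)) \<partial>G)"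
      if v: "v > 0" for a v
    proof -
      have "(\<integral>\<omega>. mehler v a 1 (Y \<omega>) \<partial>M) = (\<integral>x. mehler v a 1 x \<partial>G)"
        using stein_law_mehler[OF M Y stein v] stein_law_mehler[OF G(1) _ \<open>stein_law G (\<lambda>x. x)\<close> v] G(2)
        by (simp add: measurable_cong_sets[OF G(2) refl])
      then show ?thesis
        unfolding mehler_1 using v by (simp add: integral_distr)
    qed
  qed (use G in auto)
  then show "distributed M lborel Y (\<lambda>x. ennreal (mvn_density 0 S x))"
    unfolding distributed_def G_def by (simp add: distr_cong[of M M lborel borel])
qed

end

subsection \<open>Vectorization of matrices\<close>

text \<open>The inverse of \<open>vec_cols\<close> after \<open>transpose\<close>: the index pair is
  (row, column), matching the block indexing of \<open>kronecker\<close>.\<close>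

definition unvec :: "real^('n \<times> 'd) \<Rightarrow> real^'d^'n" where
  "unvec y = (\<chi> i j. y $ (i, j))"

lemma vec_cols_transpose_nth [simp]: "vec_cols (transpose X) $ p = X $ fst p $ snd p"
  by (simp add: vec_cols_def transpose_def)

lemma unvec_nth [simp]: "unvec y $ i $ j = y $ (i, j)"
  by (simp add: unvec_def)

lemma unvec_vec_cols [simp]: "unvec (vec_cols (transpose X)) = X"
  by (simp add: vec_eq_iff)

lemma vec_cols_unvec [simp]: "vec_cols (transpose (unvec y)) = y"
  by (simp add: vec_eq_iff)

lemma bounded_linear_unvec: "bounded_linear (unvec :: real^('n \<times> 'd) \<Rightarrow> real^'d^'n)"
  unfolding linear_conv_bounded_linear[symmetric] by (rule linearI) (simp_all add: vec_eq_iff)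

lemma bounded_linear_vec_cols_transpose:
  "bounded_linear (\<lambda>X :: real^'d^'n. vec_cols (transpose X))"
  unfolding linear_conv_bounded_linear[symmetric] by (rule linearI) (simp_all add: vec_eq_iff)

lemma pd_unvec: "pd p (\<lambda>y. f (unvec y)) y = partial (fst p) (snd p) f (unvec y)"
proof -
  have "unvec (y + t *\<^sub>R axis p 1) = unvec y + t *\<^sub>R axis (fst p) (axis (snd p) 1)" for t
    by (cases p) (auto simp: vec_eq_iff axis_def)
  then show ?thesis
    by (simp add: pd_def partial_def)
qed

text \<open>Differentiability passes through the linear bijection \<open>unvec\<close> both ways,
  and \<open>pd_unvec\<close> matches the partial derivatives.\<close>

lemma C1_iff_C1_vec: "C1 f \<longleftrightarrow> C1_vec (\<lambda>y. f (unvec y))"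
proof
  assume f: "C1 f"
  have "(\<lambda>y. f (unvec y)) differentiable (at y)" for y
    by (rule differentiable_chain_at[unfolded o_def, OF bounded_linear_imp_differentiable[OF bounded_linear_unvec]])
      (use f in \<open>simp add: C1_def\<close>)
  then have "GDERIV (\<lambda>y. f (unvec y)) y :> grad (\<lambda>y. f (unvec y)) y" for y
    by (rule differentiable_imp_GDERIV)
  moreover have "continuous_on UNIV (\<lambda>y. partial i j f (unvec y))" for i j
    using f by (intro continuous_on_compose2[OF _ linear_continuous_on[OF bounded_linear_unvec]])
      (auto simp: C1_def)
  then have "continuous_on UNIV (grad (\<lambda>y. f (unvec y)))"
    unfolding grad_def[abs_def] pd_unvec by (intro continuous_on_vec_lambda)
  ultimately show "C1_vec (\<lambda>y. f (unvec y))"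
    by (simp add: C1_vec_def)
next
  let ?V = "\<lambda>X. vec_cols (transpose X)"
  assume f: "C1_vec (\<lambda>y. f (unvec y))"
  have "f differentiable (at X)" for X
  proof -
    have "(\<lambda>y. f (unvec y)) differentiable (at (?V X))"
      using C1_vecD(1)[OF f] by (auto simp: differentiable_def gderiv_def)
    then have "(\<lambda>X. f (unvec (?V X))) differentiable (at X)"
      by (rule differentiable_chain_at[unfolded o_def,
            OF bounded_linear_imp_differentiable[OF bounded_linear_vec_cols_transpose]])
    then show ?thesis by simp
  qed
  moreover have "continuous_on UNIV (partial i j f)" for i j
  proof -
    have "continuous_on UNIV (\<lambda>X. pd (i, j) (\<lambda>y. f (unvec y)) (?V X))"
      by (rule continuous_on_compose2[OF C1_vecD(3)[OF f, of UNIV] linear_continuous_on[OF bounded_linear_vec_cols_transpose]]) simp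
    then show ?thesis
      by (simp add: pd_unvec)
  qed
  ultimately show "C1 f"
    by (simp add: C1_def)
qed

text \<open>As \<open>pd_unvec\<close> is an identity of functions, \<open>C1_iff_C1_vec\<close>
  applies again to each first partial derivative.\<close>

lemma C2_iff_C2_vec: "C2 f \<longleftrightarrow> C2_vec (\<lambda>y. f (unvec y))"
  unfolding C2_def C2_vec_def C1_iff_C1_vec pd_unvec[abs_def] by auto

lemma sum_UNIV_prod:
  "(\<Sum>p\<in>UNIV. g p) = (\<Sum>i\<in>(UNIV :: 'i::finite set). \<Sum>j\<in>(UNIV :: 'j::finite set). g (i, j))"
  by (simp add: sum.cartesian_product case_prod_beta)

lemma drift_term_eq: "drift_term f X = drift (\<lambda>y. f (unvec y)) (vec_cols (transpose X))"
proof -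
  have "drift_term f X = (\<Sum>j\<in>UNIV. \<Sum>i\<in>UNIV. X $ i $ j * partial i j f X)"
    by (simp add: drift_term_def trace_def matrix_matrix_mult_def transpose_def nabla_def)
  also have "\<dots> = (\<Sum>p\<in>UNIV. X $ fst p $ snd p * partial (fst p) (snd p) f X)"
    by (subst sum.swap) (simp add: sum_UNIV_prod)
  finally show ?thesis
    by (simp add: drift_def grad_def pd_unvec inner_vec_def)
qed

lemma diffusion_term_eq:
  "diffusion_term \<Psi> \<Sigma> f X = diffusion (kronecker \<Psi> \<Sigma>) (\<lambda>y. f (unvec y)) (vec_cols (transpose X))"
proof -
  \<comment> \<open>Swapping the two inner sums groups \<open>(i, j)\<close> and
    \<open>(k, l)\<close> into the row and column indices of the Kronecker product.\<close>
  have "diffusion_term \<Psi> \<Sigma> f X = (\<Sum>i\<in>UNIV. \<Sum>j\<in>UNIV. \<Sum>k\<in>UNIV. \<Sum>l\<in>UNIV.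
      \<Psi> $ i $ k * \<Sigma> $ j $ l * partial i j (partial k l f) X)"
    unfolding diffusion_term_def by (intro sum.cong refl sum.swap)
  also have "\<dots> = (\<Sum>p\<in>UNIV. \<Sum>r\<in>UNIV. \<Psi> $ fst p $ fst r * \<Sigma> $ snd p $ snd r *
      partial (fst p) (snd p) (partial (fst r) (snd r) f) X)"
    by (simp add: sum_UNIV_prod)
  finally show ?thesis
    by (simp add: diffusion_def kronecker_def pd_unvec[abs_def])
qed

theorem corollary1:
  fixes M :: "'a measure"
    and X :: "'a \<Rightarrow> real^'d^'n"
    and \<Psi> :: "real^'n^'n"
    and \<Sigma> :: "real^'d^'d"
  assumes "prob_space M"
    and "X \<in> borel_measurable M"
    and "sym_pos_def \<Psi>"
    and "sym_pos_def \<Sigma>"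
  shows "matrix_normal M X 0 \<Psi> \<Sigma> \<longleftrightarrow>
    (\<forall>f \<in> OU_class M X \<Psi> \<Sigma>. (\<integral>\<omega>. OU_generator \<Psi> \<Sigma> f (X \<omega>) \<partial>M) = 0)"
proof -
  obtain A :: "real^'n^'n" where A: "invertible A" "\<Psi> = A ** transpose A"
    using sym_pos_def_factorization[OF assms(3)] .
  obtain B :: "real^'d^'d" where B: "invertible B" "\<Sigma> = B ** transpose B"
    using sym_pos_def_factorization[OF assms(4)] .
  \<comment> \<open>The Kronecker product of the square roots is a square root of the Kronecker
    product, by \<open>kronecker_mult\<close>.\<close>
  interpret gaussian_factor "kronecker A B" "kronecker \<Psi> \<Sigma>" "matrix_inv (kronecker \<Psi> \<Sigma>)"
    by standard (simp_all add: A B invertible_kronecker transpose_kronecker kronecker_mult)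
  define Y where "Y \<omega> = vec_cols (transpose (X \<omega>))" for \<omega>
  have Y: "Y \<in> borel_measurable M"
    unfolding Y_def
    by (rule measurable_compose[OF assms(2) borel_measurable_continuous_onI])
      (rule linear_continuous_on[OF bounded_linear_vec_cols_transpose])
  have "vec_cols (transpose (0 :: real^'d^'n)) = 0"
    by (simp add: vec_eq_iff)
  then have "matrix_normal M X 0 \<Psi> \<Sigma> \<longleftrightarrow> stein_law M Y"
    unfolding matrix_normal_def multivariate_normal_def Y_def[symmetric]
    by (simp add: stein_characterization[OF assms(1) Y])
  also have "stein_law M Y \<longleftrightarrow>
      (\<forall>f \<in> OU_class M X \<Psi> \<Sigma>. (\<integral>\<omega>. OU_generator \<Psi> \<Sigma> f (X \<omega>) \<partial>M) = 0)"
  proof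
    assume stein: "stein_law M Y"
    show "\<forall>f \<in> OU_class M X \<Psi> \<Sigma>. (\<integral>\<omega>. OU_generator \<Psi> \<Sigma> f (X \<omega>) \<partial>M) = 0"
    proof
      fix f assume "f \<in> OU_class M X \<Psi> \<Sigma>"
      then have "C2_vec (\<lambda>y. f (unvec y))" "integrable M (\<lambda>\<omega>. drift (\<lambda>y. f (unvec y)) (Y \<omega>))"
        "integrable M (\<lambda>\<omega>. diffusion (kronecker \<Psi> \<Sigma>) (\<lambda>y. f (unvec y)) (Y \<omega>))"
        by (simp_all only: OU_class_def mem_Collect_eq C2_iff_C2_vec drift_term_eq diffusion_term_eq Y_def)
      from stein[unfolded stein_law_def, rule_format, OF this]
      show "(\<integral>\<omega>. OU_generator \<Psi> \<Sigma> f (X \<omega>) \<partial>M) = 0"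
        by (simp only: OU_generator_def drift_term_eq diffusion_term_eq Y_def)
    qed
  next
    assume *: "\<forall>f \<in> OU_class M X \<Psi> \<Sigma>. (\<integral>\<omega>. OU_generator \<Psi> \<Sigma> f (X \<omega>) \<partial>M) = 0"
    show "stein_law M Y"
      unfolding stein_law_def
    proof (intro allI impI)
      fix g :: "real^('n \<times> 'd) \<Rightarrow> real"
      assume g: "C2_vec g" "integrable M (\<lambda>\<omega>. drift g (Y \<omega>))"
        "integrable M (\<lambda>\<omega>. diffusion (kronecker \<Psi> \<Sigma>) g (Y \<omega>))"
      \<comment> \<open>Since \<open>unvec\<close> is invertible, each test function on vectors
        comes from one on matrices, so the hypothesis covers all of
        \<open>stein_law\<close>.\<close>
      let ?f = "\<lambda>X. g (vec_cols (transpose X))"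
      have "?f \<in> OU_class M X \<Psi> \<Sigma>"
        using g by (simp only: OU_class_def mem_Collect_eq C2_iff_C2_vec drift_term_eq diffusion_term_eq
            Y_def vec_cols_unvec simp_thms)
      with * have "(\<integral>\<omega>. OU_generator \<Psi> \<Sigma> ?f (X \<omega>) \<partial>M) = 0"
        by (rule bspec)
      then show "(\<integral>\<omega>. - drift g (Y \<omega>) + diffusion (kronecker \<Psi> \<Sigma>) g (Y \<omega>) \<partial>M) = 0"
        by (simp only: OU_generator_def drift_term_eq diffusion_term_eq Y_def vec_cols_unvec)
    qed
  qed
  finally show ?thesis .
qed

end
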